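(* Fix a constant integer $r\ge 2$. If $P$ is an $r$-partite $r$-pattern, then \[N_P(n)=e^{O_r(n)}\, n^{(r-1-1/(r-1))n}.\]
   Context: An (ordered) $r$-matching is an $r$-uniform hypergraph on a totally ordered vertex set in which every vertex is contained in exactly one edge; its size is its number of edges. An $r$-matching is $r$-partite if, when the vertex set is divided into $r$ contiguous intervals of equal length, every edge has exactly one vertex in each interval. An $r$-pattern is an $r$-matching of size $2$ on the vertex set $\{1,\dots,2r\}$. $N_P(n)$ denotes the number of $r$-matchings on the vertex set $\{1,\dots,rn\}$ which are $P$-free, i.e. in which no two edges (with the induced ordering on their $2r$ vertices) are order-isomorphic to $P$. Asymptotics are as $n\to\infty$; $f(n)=e^{O_r(n)}g(n)$ means that there is a constant $C$ depending only on $r$ such that $e^{-Cn}g(n)\le f(n)\le e^{Cn}g(n)$ for all sufficiently large $n$. *)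

theory Defs
  imports Complex_Main
begin

definition ordered_matching :: "nat \<Rightarrow> 'a::linorder set \<Rightarrow> 'a set set \<Rightarrow> bool" where
  "ordered_matching r V M \<longleftrightarrow>
     finite V \<and> (\<forall>e\<in>M. e \<subseteq> V \<and> card e = r) \<and> (\<forall>v\<in>V. \<exists>!e. e \<in> M \<and> v \<in> e)"

(* The vertex set is {1..r*n}; the i-th interval is {i*n+1..(i+1)*n} for i = 0, ..., r-1. *)
definition partite_matching :: "nat \<Rightarrow> nat \<Rightarrow> nat set set \<Rightarrow> bool" where
  "partite_matching r n M \<longleftrightarrow>
     ordered_matching r {1..r * n} M \<and>
     (\<forall>e\<in>M. \<forall>i<r. card (e \<inter> {i * n + 1..(i + 1) * n}) = 1)"

definition is_pattern :: "nat \<Rightarrow> nat set set \<Rightarrow> bool" where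
  "is_pattern r P \<longleftrightarrow> ordered_matching r {1..2 * r} P \<and> card P = 2"

definition partite_pattern :: "nat \<Rightarrow> nat set set \<Rightarrow> bool" where
  "partite_pattern r P \<longleftrightarrow> is_pattern r P \<and> partite_matching r 2 P"

(* Hypergraphs are given by their edge sets; the vertex set is the union of the edges,
   i.e. there are no isolated vertices. *)
definition order_isomorphic ::
    "'a::linorder set set \<Rightarrow> 'b::linorder set set \<Rightarrow> bool" where
  "order_isomorphic M N \<longleftrightarrow>
     (\<exists>\<phi>. strict_mono_on (\<Union>M) \<phi> \<and> (\<lambda>e. \<phi> ` e) ` M = N)"

definition pattern_free :: "nat set set \<Rightarrow> 'a::linorder set set \<Rightarrow> bool" where
  "pattern_free P M \<longleftrightarrow>
     \<not> (\<exists>e\<in>M. \<exists>f\<in>M. e \<noteq> f \<and> order_isomorphic {e, f} P)"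

definition num_pattern_free :: "nat \<Rightarrow> nat set set \<Rightarrow> nat \<Rightarrow> nat" where
  "num_pattern_free r P n =
     card {M :: nat set set. ordered_matching r {1..r * n} M \<and> pattern_free P M}"

lemma finite_ordered_matchings:
  "finite {M. ordered_matching r {1..r * n} M \<and> pattern_free P M}"
proof (rule finite_subset)
  show "{M. ordered_matching r {1..r * n} M \<and> pattern_free P M} \<subseteq> Pow (Pow {1..r * n})"
    by (auto simp: ordered_matching_def)
qed simp

end

theory Submission
  imports Defs "HOL-Combinatorics.Multiset_Permutations"
begin

text \<open>
  Let $P = \{p, q\}$ be $r$-partite and let $D$ be the set of coordinates $i$ with $p_i < q_i$.
  Two edges $a_0 < \dots < a_{r-1}$ and $b_0 < \dots < b_{r-1}$ form a copy of $P$ exactly when, up to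
  exchanging $a$ and $b$, every $a_i, b_i$ lies below every $a_{i+1}, b_{i+1}$ and $a_i < b_i$ holds
  precisely for $i \in D$. So pattern-freeness is a condition on the family of increasing $r$-tuples,
  resembling that of an antichain in a product of $r$ chains, and the exponent comes from covering a
  hypersurface of dimension $r-1$ by about $n$ cells: with $m \approx n^{1/(r-1)}$ blocks per axis,
  each block has about $n/m$ vertices, each edge has $e^{O(1)} (n/m)^r$ possible positions on average,
  and $(n/m)^r = n^{r-1-1/(r-1)}$.

  Upper bound. A family of increasing $r$-tuples over $[m]$ without a copy of the pattern has only
  $O(m^{r-1})$ members (card_avoiding). The proof is a deletion argument: if the family is larger, then
  some tuple $a$ of it can be raised, inside the family, exactly in the coordinates in $D$, and also
  exactly in the coordinates outside $D$, each time without passing the next coordinate of $a$; the two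
  raised tuples form the pattern. The number of such families is then $2^{O(m^{r-1})}$
  (card_avoiding_families): halving the resolution maps families over $[2m]$ to families over $[m]$, and
  a family over $[m]$ with $O(m^{r-1})$ members has at most $2^{O(m^{r-1})}$ refinements, so the exponents
  form a geometric series. Now cut the $rn$ vertices into $m$ blocks of equal length. The tuples of blocks met
  by the edges of a pattern-free matching form such a family $S$, which leaves $e^{O(n)}$ choices for $S$,
  and then all $n$ edges are chosen from the at most $|S| \cdot O(n/m)^r = O(n) \cdot O(n/m)^r$ sets that fit
  into a cell of $S$ (num_pattern_free_upper_nat).

  Lower bound. Choose $n$ tuples in $[0, rk]^r$, with $k \approx n^{1/(r-1)}$, on a hyperplane
  $\sum_i \pm c_i = \mathrm{const}$ with signs given by $D$; they form an antichain
  for the order twisted by $D$ (exists_antichain). In every coordinate independently, list the $n$ tuples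
  in any order for which that coordinate is nondecreasing, and let the
  $i$-th vertex of the edge of a tuple be its place in the $i$-th list, inside the $i$-th interval. These
  matchings are distinct and pattern-free, and each coordinate admits at least $n!/(rk+1)^n$ lists
  (card_sorted_enums), which together gives $e^{-O(n)} (n/k)^{rn}$ matchings.
\<close>

section \<open>Tuples that avoid a sign pattern\<close>

definition drop_nth :: "nat \<Rightarrow> 'a list \<Rightarrow> 'a list" where
  "drop_nth i xs = take i xs @ drop (Suc i) xs"

lemma length_drop_nth: "i < length xs \<Longrightarrow> length (drop_nth i xs) = length xs - 1"
  by (simp add: drop_nth_def)

lemma set_drop_nth: "set (drop_nth i xs) \<subseteq> set xs"
  by (auto simp: drop_nth_def dest: in_set_takeD in_set_dropD)

lemma drop_nth_eqD:
  assumes "drop_nth i xs = drop_nth i ys" "length xs = length ys" "i < length xs"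
    and "j < length xs" "j \<noteq> i"
  shows "xs ! j = ys ! j"
proof -
  have t: "take i xs = take i ys" and d: "drop (Suc i) xs = drop (Suc i) ys"
    using assms(1-3) by (auto simp: drop_nth_def append_eq_append_conv)
  show ?thesis
  proof (cases "j < i")
    case True
    then show ?thesis using t by (metis nth_take)
  next
    case False
    then obtain k where k: "j = Suc i + k"
      using \<open>j \<noteq> i\<close> by (metis Suc_leI le_add_diff_inverse linorder_neqE_nat)
    have "xs ! j = drop (Suc i) xs ! k" "ys ! j = drop (Suc i) ys ! k"
      using k assms by simp_all
    then show ?thesis using d by simp
  qed
qed

text \<open>
  Deleting one coordinate is injective on a family in which the others determine it. This
  is the only source of the bound $m^{r-1}$: it is applied to tuples that are
  highest in a family along an axis, and to tuples with two equal neighbouring entries.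
\<close>

lemma card_le_by_drop_nth:
  assumes "i < r"
    and dim: "\<And>a. a \<in> T \<Longrightarrow> length a = r \<and> set a \<subseteq> {..<m::nat}"
    and det: "\<And>a b. a \<in> T \<Longrightarrow> b \<in> T \<Longrightarrow> (\<And>j. j < r \<Longrightarrow> j \<noteq> i \<Longrightarrow> a ! j = b ! j) \<Longrightarrow> a ! i = b ! i"
  shows "card T \<le> m ^ (r - 1)"
proof -
  have "inj_on (drop_nth i) T"
  proof (rule inj_onI)
    fix a b assume ab: "a \<in> T" "b \<in> T" "drop_nth i a = drop_nth i b"
    have same: "a ! j = b ! j" if "j < r" "j \<noteq> i" for j
      using drop_nth_eqD[OF ab(3), of j] dim ab that \<open>i < r\<close> by simp
    moreover have "a ! i = b ! i" by (rule det) (use ab same in auto)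
    ultimately show "a = b"
      using dim ab by (metis nth_equalityI)
  qed
  moreover have "drop_nth i ` T \<subseteq> {xs. set xs \<subseteq> {..<m} \<and> length xs = r - 1}"
    using dim \<open>i < r\<close> set_drop_nth by (fastforce simp: length_drop_nth)
  ultimately have "card T \<le> card {xs. set xs \<subseteq> {..<m} \<and> length xs = r - 1}"
    by (intro card_inj_on_le) (auto simp: finite_lists_length_eq)
  then show ?thesis by (simp add: card_lists_length_eq)
qed

text \<open>
  The last clause keeps the raised tuple below the next coordinate of the tuple
  from which it was raised. Two tuples that climb from the same tuple $a$ are then automatically
  interleaved, since the entries $a_{i+1}$ separate their $i$-th entries from the later ones.
\<close>

definition climbs :: "nat set \<Rightarrow> nat list \<Rightarrow> nat list \<Rightarrow> bool" where
  "climbs D a b \<longleftrightarrow>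
     (\<forall>i<length a. if i \<in> D then a ! i < b ! i else b ! i = a ! i) \<and>
     (\<forall>i. Suc i < length a \<longrightarrow> b ! i < a ! Suc i)"

text \<open>
  The coordinates in $D$ are raised one at a time, the smallest first. A tuple fails only if it is
  the highest one on its axis-parallel line at some stage, which costs at most $m^{r-1}$ tuples per
  coordinate. The order matters: when coordinate $i$ is raised, coordinate $i+1$ still has
  its original value, and since every intermediate tuple is in the family and hence increasing, the new
  $i$-th entry stays below $a_{i+1}$.
\<close>

lemma climbs_all_but_few:
  assumes "finite D" "D \<subseteq> {..<r}"
    and H: "H \<subseteq> {a. length a = r \<and> sorted_wrt (<) a \<and> set a \<subseteq> {..<m}}"
  shows "card {a \<in> H. \<not> (\<exists>b\<in>H. climbs D a b)} \<le> card D * m ^ (r - 1)"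
  using assms(1,2)
proof (induction D rule: finite_linorder_min_induct)
  case empty
  have "climbs {} a a" if "a \<in> H" for a
    using that H by (auto simp: climbs_def sorted_wrt_iff_nth_less)
  then have "{a \<in> H. \<not> (\<exists>b\<in>H. climbs {} a b)} = {}" by blast
  then show ?case by (metis card.empty zero_le)
next
  case (insert d D)
  have finH: "finite H"
    by (rule finite_subset[OF _ finite_lists_length_eq[of "{..<m}" r]]) (use H in auto)
  define G where "G = {a \<in> H. \<exists>b\<in>H. climbs D a b}"
  \<comment> \<open>From \<open>G\<close> minus \<open>T\<close> one can first raise coordinate \<open>d\<close> within \<open>G\<close> and then climb in \<open>D\<close>.\<close>
  define T where "T = {a \<in> G. \<forall>x > a ! d. a[d := x] \<notin> G}"
  have "d < r" and dD: "\<And>i. i \<in> D \<Longrightarrow> d < i" using insert by auto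
  have "card T \<le> m ^ (r - 1)"
  proof (rule card_le_by_drop_nth[OF \<open>d < r\<close>])
    fix a assume "a \<in> T" then show "length a = r \<and> set a \<subseteq> {..<m}" using H by (auto simp: T_def G_def)
  next
    fix a b assume ab: "a \<in> T" "b \<in> T" and eq: "\<And>j. j < r \<Longrightarrow> j \<noteq> d \<Longrightarrow> a ! j = b ! j"
    have len: "length a = r" "length b = r" using ab H by (auto simp: T_def G_def)
    have upd: "x[d := y ! d] = y" if "length x = r" "length y = r" "\<And>j. j < r \<Longrightarrow> j \<noteq> d \<Longrightarrow> x ! j = y ! j"
      for x y :: "nat list"
    proof (rule nth_equalityI)
      fix i assume "i < length (x[d := y ! d])"
      then show "x[d := y ! d] ! i = y ! i" using that by (cases "i = d") auto
    qed (use that in simp)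
    have "a[d := b ! d] = b" "b[d := a ! d] = a"
      using upd[of a b] upd[of b a] len eq by simp_all
    then show "a ! d = b ! d" using ab unfolding T_def
      by (metis (no_types, lifting) linorder_neqE_nat mem_Collect_eq)
  qed
  moreover have "{a \<in> H. \<not> (\<exists>b\<in>H. climbs (insert d D) a b)}
      \<subseteq> {a \<in> H. \<not> (\<exists>b\<in>H. climbs D a b)} \<union> T"
  proof (rule subsetI, rule ccontr)
    fix a assume a: "a \<in> {a \<in> H. \<not> (\<exists>b\<in>H. climbs (insert d D) a b)}"
      and na: "a \<notin> {a \<in> H. \<not> (\<exists>b\<in>H. climbs D a b)} \<union> T"
    have aG: "a \<in> G" "a \<notin> T" using a na by (auto simp: G_def)
    then obtain x where x: "x > a ! d" "a[d := x] \<in> G" by (auto simp: T_def)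
    then obtain b where b: "b \<in> H" "climbs D (a[d := x]) b" by (auto simp: G_def)
    have len: "length a = r" and srt: "sorted_wrt (<) a" using a H by auto
    have b1: "if i \<in> D then a[d := x] ! i < b ! i else b ! i = a[d := x] ! i" if "i < r" for i
      using b(2) that len unfolding climbs_def by simp
    have b2: "b ! i < a[d := x] ! Suc i" if "Suc i < r" for i
      using b(2) that len unfolding climbs_def by simp
    have "climbs (insert d D) a b"
      unfolding climbs_def
    proof (intro conjI allI impI)
      fix i assume "i < length a"
      then show "if i \<in> insert d D then a ! i < b ! i else b ! i = a ! i"
        using b1[of i] x(1) len dD[of i] by (cases "i = d") (auto split: if_splits)
    next
      fix i assume i: "Suc i < length a"
      show "b ! i < a ! Suc i"
      proof (cases "Suc i = d")
        case True
        then have "i \<notin> D" using dD by fastforce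
        then have "b ! i = a ! i" using b1[of i] i len True by auto
        then show ?thesis using srt i by (simp add: sorted_wrt_iff_nth_less)
      next
        case False
        then show ?thesis using b2[of i] i len by simp
      qed
    qed
    then show False using a b by blast
  qed
  ultimately have "card {a \<in> H. \<not> (\<exists>b\<in>H. climbs (insert d D) a b)}
      \<le> card {a \<in> H. \<not> (\<exists>b\<in>H. climbs D a b)} + m ^ (r - 1)"
    by (smt (verit, del_insts) G_def T_def add_left_mono card_Un_le card_mono dual_order.trans
        finH finite_Un finite_subset mem_Collect_eq subsetI)
  also have "\<dots> \<le> card D * m ^ (r - 1) + m ^ (r - 1)" using insert by simp
  also have "\<dots> = card (insert d D) * m ^ (r - 1)" using insert dD by (subst card_insert_disjoint) auto
  finally show ?case .
qed

text \<open>
  The strict product order on tuples, with the order reversed in the coordinates outside $D$.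
\<close>

definition twisted_less :: "nat set \<Rightarrow> nat list \<Rightarrow> nat list \<Rightarrow> bool" where
  "twisted_less D a b \<longleftrightarrow> (\<forall>i<length a. if i \<in> D then a ! i < b ! i else b ! i < a ! i)"

definition interleaved :: "nat list \<Rightarrow> nat list \<Rightarrow> bool" where
  "interleaved a b \<longleftrightarrow>
     (\<forall>i. Suc i < length a \<longrightarrow> max (a ! i) (b ! i) < min (a ! Suc i) (b ! Suc i))"

definition avoids :: "nat set \<Rightarrow> nat list set \<Rightarrow> bool" where
  "avoids D H \<longleftrightarrow> (\<forall>a\<in>H. \<forall>b\<in>H. \<not> (twisted_less D a b \<and> interleaved a b))"

definition cells :: "nat \<Rightarrow> nat \<Rightarrow> nat list set" where
  "cells r m = {a. length a = r \<and> sorted a \<and> set a \<subseteq> {..<m}}"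

lemma finite_cells: "finite (cells r m)"
  by (rule finite_subset[OF _ finite_lists_length_eq[of "{..<m}" r]]) (auto simp: cells_def)

text \<open>
  If $b$ climbs from $a$ in the coordinates in $D$, and $c$ climbs from $a$ in the other coordinates,
  then $c$ lies below $b$ in the twisted order and the two are interleaved. So in a family that avoids $D$
  every $a$ fails to climb in one of the two ways.
\<close>

lemma card_avoiding_strict:
  assumes H: "H \<subseteq> {a. length a = r \<and> sorted_wrt (<) a \<and> set a \<subseteq> {..<m}}"
    and av: "avoids D H"
  shows "card H \<le> r * m ^ (r - 1)"
proof -
  define D1 D2 where "D1 = D \<inter> {..<r}" and "D2 = {..<r} - D"
  have bad: "H \<subseteq> {a \<in> H. \<not> (\<exists>b\<in>H. climbs D1 a b)} \<union> {a \<in> H. \<not> (\<exists>b\<in>H. climbs D2 a b)}"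
  proof (rule subsetI, rule ccontr)
    fix a assume a: "a \<in> H"
      and "a \<notin> {a \<in> H. \<not> (\<exists>b\<in>H. climbs D1 a b)} \<union> {a \<in> H. \<not> (\<exists>b\<in>H. climbs D2 a b)}"
    then obtain b c where b: "b \<in> H" "climbs D1 a b" and c: "c \<in> H" "climbs D2 a c" by blast
    have len: "length a = r" "length b = r" "length c = r" using a b c H by auto
    have b1: "if i \<in> D then a ! i < b ! i else b ! i = a ! i"
      and c1: "if i \<in> D then c ! i = a ! i else a ! i < c ! i" if "i < r" for i
      using b(2) c(2) that len unfolding climbs_def D1_def D2_def by auto
    have bc2: "b ! i < a ! Suc i" "c ! i < a ! Suc i" if "Suc i < r" for i
      using b(2) c(2) that len unfolding climbs_def by auto
    have "twisted_less D c b"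
      unfolding twisted_less_def using b1 c1 len by auto
    moreover have "interleaved c b"
      unfolding interleaved_def
    proof (intro allI impI)
      fix i assume i: "Suc i < length c"
      have "a ! Suc i \<le> b ! Suc i" "a ! Suc i \<le> c ! Suc i"
        using b1[of "Suc i"] c1[of "Suc i"] i len by (auto split: if_splits)
      then show "max (c ! i) (b ! i) < min (c ! Suc i) (b ! Suc i)"
        using bc2[of i] i len by simp
    qed
    ultimately show False using av b c by (auto simp: avoids_def)
  qed
  have finH: "finite H"
    by (rule finite_subset[OF _ finite_lists_length_eq[of "{..<m}" r]]) (use H in auto)
  have "card H \<le> card ({a \<in> H. \<not> (\<exists>b\<in>H. climbs D1 a b)} \<union> {a \<in> H. \<not> (\<exists>b\<in>H. climbs D2 a b)})"
    using bad finH by (intro card_mono) auto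
  also have "\<dots> \<le> card {a \<in> H. \<not> (\<exists>b\<in>H. climbs D1 a b)} + card {a \<in> H. \<not> (\<exists>b\<in>H. climbs D2 a b)}"
    by (rule card_Un_le)
  also have "\<dots> \<le> card D1 * m ^ (r - 1) + card D2 * m ^ (r - 1)"
    by (intro add_mono climbs_all_but_few) (use H in \<open>auto simp: D1_def D2_def\<close>)
  also have "\<dots> = card (D1 \<union> D2) * m ^ (r - 1)"
    by (subst card_Un_disjoint) (auto simp: D1_def D2_def add_mult_distrib)
  also have "D1 \<union> D2 = {..<r}" by (auto simp: D1_def D2_def)
  finally show ?thesis by simp
qed

text \<open>
  Cells may have repeated entries, because an edge can have several vertices in one block; those
  tuples number at most $(r-1) m^{r-1}$.
\<close>

lemma card_avoiding:
  assumes "H \<subseteq> cells r m" "avoids D H"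
  shows "card H \<le> 2 * r * m ^ (r - 1)"
proof -
  define S where "S = {a \<in> H. sorted_wrt (<) a}"
  define R where "R i = {a \<in> H. a ! i = a ! Suc i}" for i
  have len: "length a = r" "set a \<subseteq> {..<m}" "sorted a" if "a \<in> H" for a
    using that assms(1) by (auto simp: cells_def)
  have "avoids D S" using assms(2) by (auto simp: avoids_def S_def)
  then have S: "card S \<le> r * m ^ (r - 1)"
    by (intro card_avoiding_strict[of _ _ _ D]) (use len in \<open>auto simp: S_def\<close>)
  have R: "card (R i) \<le> m ^ (r - 1)" if "i < r - 1" for i
  proof (rule card_le_by_drop_nth[where i = i])
    show "i < r" using that by simp
    show "length a = r \<and> set a \<subseteq> {..<m}" if "a \<in> R i" for a using len that by (auto simp: R_def)
    show "a ! i = b ! i" if "a \<in> R i" "b \<in> R i"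
      "\<And>j. j < r \<Longrightarrow> j \<noteq> i \<Longrightarrow> a ! j = b ! j" for a b
      using that(1,2) that(3)[of "Suc i"] \<open>i < r - 1\<close> by (auto simp: R_def)
  qed
  have "H \<subseteq> S \<union> (\<Union>i<r - 1. R i)"
  proof
    fix a assume a: "a \<in> H"
    show "a \<in> S \<union> (\<Union>i<r - 1. R i)"
    proof (rule ccontr)
      assume "a \<notin> S \<union> (\<Union>i<r - 1. R i)"
      then have ns: "\<not> sorted_wrt (<) a" and ne: "\<And>i. i < r - 1 \<Longrightarrow> a ! i \<noteq> a ! Suc i"
        using a by (auto simp: S_def R_def)
      have "a ! i < a ! Suc i" if "Suc i < length a" for i
      proof -
        have "a ! i \<noteq> a ! Suc i" using ne[of i] that len(1)[OF a] by simp
        moreover have "a ! i \<le> a ! Suc i" using that len(3)[OF a] by (simp add: sorted_iff_nth_Suc)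
        ultimately show ?thesis by simp
      qed
      then show False using ns by (metis sorted_wrt_iff_nth_Suc_transp transp_on_less)
    qed
  qed
  moreover have "finite H" using assms(1) finite_cells finite_subset by blast
  ultimately have "card H \<le> card (S \<union> (\<Union>i<r - 1. R i))"
    by (intro card_mono) (auto simp: S_def R_def)
  also have "\<dots> \<le> card S + (\<Sum>i<r - 1. card (R i))"
    by (rule order_trans[OF card_Un_le]) (simp add: card_UN_le)
  also have "\<dots> \<le> r * m ^ (r - 1) + (r - 1) * m ^ (r - 1)"
    using sum_bounded_above[of "{..<r - 1}" "\<lambda>i. card (R i)" "m ^ (r - 1)"] R S by auto
  also have "\<dots> \<le> 2 * r * m ^ (r - 1)" by (simp add: mult_2 add_mult_distrib)
  finally show ?thesis .
qed

section \<open>Counting avoiding families by coarsening\<close>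

lemma card_le_fibers:
  assumes "finite B" "f ` A \<subseteq> B" "\<And>b. b \<in> B \<Longrightarrow> finite {a \<in> A. f a = b} \<and> card {a \<in> A. f a = b} \<le> k"
  shows "card A \<le> card B * k"
proof -
  have "(\<Union>b\<in>B. {a \<in> A. f a = b}) = A" using assms(2) by auto
  then have "card A \<le> (\<Sum>b\<in>B. card {a \<in> A. f a = b})"
    using card_UN_le[OF assms(1), of "\<lambda>b. {a \<in> A. f a = b}"] by simp
  also have "\<dots> \<le> card B * k" using sum_bounded_above[of B _ k] assms by auto
  finally show ?thesis .
qed

definition coarsen :: "nat \<Rightarrow> nat list \<Rightarrow> nat list" where
  "coarsen L = map (\<lambda>x. x div L)"

lemma length_coarsen [simp]: "length (coarsen L a) = length a"
  by (simp add: coarsen_def)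

lemma less_of_div_less: "x div L < y div L \<Longrightarrow> x < (y::nat)"
  by (meson div_le_mono leD leI)

lemma twisted_less_coarsen:
  assumes "length a = length b" "twisted_less D (coarsen L a) (coarsen L b)" shows "twisted_less D a b"
  using assms unfolding twisted_less_def coarsen_def
  by (auto split: if_splits dest: less_of_div_less)

lemma interleaved_coarsen:
  assumes "length a = length b" "interleaved (coarsen L a) (coarsen L b)" shows "interleaved a b"
  using assms unfolding interleaved_def coarsen_def
  by (auto dest: less_of_div_less)

text \<open>
  Strict inequalities between blocks imply the same inequalities between
  points in them, so a pattern among cells would already be a pattern among points.
\<close>

lemma avoids_coarsen:
  assumes "avoids D H" "\<And>a. a \<in> H \<Longrightarrow> length a = r"
  shows "avoids D (coarsen L ` H)"
  unfolding avoids_def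
proof safe
  fix a b
  assume ab: "a \<in> H" "b \<in> H" "twisted_less D (coarsen L a) (coarsen L b)"
    "interleaved (coarsen L a) (coarsen L b)"
  then have "length a = length b" using assms(2) by simp
  then have "twisted_less D a b" "interleaved a b"
    using ab(3,4) by (blast intro: twisted_less_coarsen interleaved_coarsen)+
  then show False using assms(1) ab(1,2) by (auto simp: avoids_def)
qed

lemma card_coarsen_fiber:
  assumes "L > 0"
  shows "finite {a. length a = r \<and> coarsen L a = c} \<and> card {a. length a = r \<and> coarsen L a = c} \<le> L ^ r"
proof -
  let ?F = "{a. length a = r \<and> coarsen L a = c}" and ?T = "{a. set a \<subseteq> {..<L} \<and> length a = r}"
  have inj: "inj_on (map (\<lambda>x. x mod L)) ?F"
  proof (rule inj_onI)
    fix a b assume ab: "a \<in> ?F" "b \<in> ?F" and eq: "map (\<lambda>x. x mod L) a = map (\<lambda>x. x mod L) b"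
    have len: "length a = length b" and eq': "coarsen L a = coarsen L b" using ab by auto
    show "a = b"
    proof (rule nth_equalityI[OF len])
      fix i assume i: "i < length a"
      have "a ! i mod L = b ! i mod L" "a ! i div L = b ! i div L"
        using i len arg_cong[OF eq, of "\<lambda>x. x ! i"] arg_cong[OF eq', of "\<lambda>x. x ! i"]
        by (simp_all add: coarsen_def)
      then show "a ! i = b ! i" by (metis div_mult_mod_eq)
    qed
  qed
  have sub: "map (\<lambda>x. x mod L) ` ?F \<subseteq> ?T" using assms by auto
  have "finite ?T" by (simp add: finite_lists_length_eq)
  then have "finite ?F" "card ?F \<le> card ?T"
    using inj sub by (meson inj_on_finite, meson card_inj_on_le)
  then show ?thesis by (simp add: card_lists_length_eq)
qed

definition avoiding_families :: "nat set \<Rightarrow> nat \<Rightarrow> nat \<Rightarrow> nat list set set" where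
  "avoiding_families D r m = {H. H \<subseteq> cells r m \<and> avoids D H}"

lemma finite_avoiding_families: "finite (avoiding_families D r m)"
  by (rule finite_subset[of _ "Pow (cells r m)"]) (auto simp: avoiding_families_def finite_cells)

lemma coarsen_avoiding_families:
  assumes "H \<subseteq> {a. length a = r \<and> sorted a \<and> set a \<subseteq> {..<L * m}}" "avoids D H"
  shows "coarsen L ` H \<in> avoiding_families D r m"
proof -
  have "sorted (coarsen L a)" if "sorted a" for a
    using that unfolding coarsen_def by (auto simp: sorted_iff_nth_mono intro: div_le_mono)
  moreover have "x div L < m" if "x < L * m" for x
    using that by (simp add: less_mult_imp_div_less mult.commute)
  ultimately have "coarsen L ` H \<subseteq> cells r m"
    using assms(1) by (fastforce simp: cells_def coarsen_def)
  moreover have "avoids D (coarsen L ` H)"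
    by (rule avoids_coarsen[OF assms(2), of r]) (use assms(1) in auto)
  ultimately show ?thesis by (simp add: avoiding_families_def)
qed

text \<open>
  A family over $[2m]$ is contained in the set of refinements of its image over $[m]$, and every cell has
  $2^r$ refinements.
\<close>

lemma card_avoiding_families_double:
  "card (avoiding_families D r (2 * m)) \<le> card (avoiding_families D r m) * 2 ^ (2 ^ r * (2 * r * m ^ (r - 1)))"
proof (rule card_le_fibers[OF finite_avoiding_families, of "image (coarsen 2)"])
  show "image (coarsen 2) ` avoiding_families D r (2 * m) \<subseteq> avoiding_families D r m"
  proof
    fix S assume "S \<in> image (coarsen 2) ` avoiding_families D r (2 * m)"
    then obtain H where "S = coarsen 2 ` H" "H \<subseteq> cells r (2 * m)" "avoids D H"
      by (auto simp: avoiding_families_def)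
    then show "S \<in> avoiding_families D r m" by (auto simp: cells_def intro: coarsen_avoiding_families)
  qed
next
  fix S assume S: "S \<in> avoiding_families D r m"
  let ?Fib = "{H \<in> avoiding_families D r (2 * m). coarsen 2 ` H = S}"
  let ?U = "\<Union>c\<in>S. {a. length a = r \<and> coarsen 2 a = c}"
  have finS: "finite S" using S finite_cells finite_subset by (auto simp: avoiding_families_def)
  have finU: "finite ?U" using finS card_coarsen_fiber[of 2 r] by auto
  have cS: "card S \<le> 2 * r * m ^ (r - 1)" using S card_avoiding by (auto simp: avoiding_families_def)
  have "card ?U \<le> (\<Sum>c\<in>S. card {a. length a = r \<and> coarsen 2 a = c})" using finS by (rule card_UN_le)
  also have "\<dots> \<le> card S * 2 ^ r"
    using sum_bounded_above[of S "\<lambda>c. card {a. length a = r \<and> coarsen 2 a = c}" "2 ^ r"]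
      card_coarsen_fiber[of 2 r] by auto
  also have "\<dots> \<le> 2 ^ r * (2 * r * m ^ (r - 1))" using cS by simp
  finally have cU: "card ?U \<le> 2 ^ r * (2 * r * m ^ (r - 1))" .
  have sub: "?Fib \<subseteq> Pow ?U"
  proof safe
    fix H a assume "H \<in> avoiding_families D r (2 * m)" "a \<in> H"
    then have "length a = r" by (auto simp: avoiding_families_def cells_def)
    with \<open>a \<in> H\<close> show "a \<in> (\<Union>c\<in>coarsen 2 ` H. {a. length a = r \<and> coarsen 2 a = c})" by auto
  qed
  have finP: "finite (Pow ?U)" using finU by (simp only: finite_Pow_iff)
  have "card ?Fib \<le> 2 ^ card ?U"
    using card_mono[OF finP sub] by (simp only: card_Pow[OF finU])
  also have "\<dots> \<le> 2 ^ (2 ^ r * (2 * r * m ^ (r - 1)))" by (rule power_increasing[OF cU]) simp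
  finally show "finite ?Fib \<and> card ?Fib \<le> 2 ^ (2 ^ r * (2 * r * m ^ (r - 1)))"
    using finite_subset[OF sub finP] by (simp only: simp_thms)
qed

text \<open>
  The constant $2^r \cdot 2r$ reproduces itself: a doubling step adds $2^r \cdot 2r \cdot 2^{t(r-1)}$
  to the exponent, and $2 \cdot 2^{t(r-1)} \le 2^{(t+1)(r-1)}$ because $r \ge 2$.
\<close>

lemma card_avoiding_families:
  assumes "r \<ge> 2"
  shows "card (avoiding_families D r (2 ^ t)) \<le> 2 ^ (2 ^ r * (2 * r) * 2 ^ (t * (r - 1)))"
proof (induction t)
  case 0
  have "a = replicate r 0" if "a \<in> cells r 1" for a
    using that by (intro replicate_eqI) (auto simp: cells_def)
  then have "avoiding_families D r 1 \<subseteq> Pow {replicate r 0}" by (auto simp: avoiding_families_def)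
  then have "card (avoiding_families D r 1) \<le> card (Pow {replicate r (0::nat)})"
    by (intro card_mono) auto
  also have "\<dots> = 2 ^ 1" by (simp add: card_Pow)
  also have "\<dots> \<le> 2 ^ (2 ^ r * (2 * r))" by (intro power_increasing) (use assms in auto)
  finally show ?case by simp
next
  case (Suc t)
  let ?B = "2 ^ r * (2 * r)" and ?x = "2 ^ (t * (r - 1)) :: nat"
  have pw: "(2 ^ t) ^ (r - 1) = ?x" by (simp add: power_mult)
  have "card (avoiding_families D r (2 ^ Suc t)) \<le> 2 ^ (?B * ?x) * 2 ^ (2 ^ r * (2 * r * ?x))"
    using card_avoiding_families_double[of D r "2 ^ t"] Suc.IH unfolding pw power_Suc
    by (meson dual_order.trans mult_le_mono1)
  also have "\<dots> = 2 ^ (?B * (2 * ?x))" by (simp add: power_add[symmetric] algebra_simps)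
  also have "\<dots> \<le> 2 ^ (?B * 2 ^ (Suc t * (r - 1)))"
  proof -
    have "2 * ?x = 2 ^ (1 + t * (r - 1))" by simp
    also have "\<dots> \<le> 2 ^ (Suc t * (r - 1))" using assms by (intro power_increasing) auto
    finally show ?thesis by (intro power_increasing mult_le_mono2) auto
  qed
  finally show ?case .
qed

section \<open>Copies of a partite pattern\<close>

lemma nth_less_of_sorted:
  fixes a :: "nat list"
  shows "sorted_wrt (<) a \<Longrightarrow> i < j \<Longrightarrow> j < length a \<Longrightarrow> a ! i < a ! j"
  by (simp add: sorted_wrt_iff_nth_less)

lemma interleaved_less:
  assumes "interleaved a b" "length b = length a" "sorted_wrt (<) a" "sorted_wrt (<) b"
    and "i < j" "j < length a"
  shows "max (a ! i) (b ! i) < min (a ! j) (b ! j)"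
proof -
  have "max (a ! i) (b ! i) < min (a ! Suc i) (b ! Suc i)"
    using assms by (auto simp: interleaved_def)
  moreover have "a ! Suc i \<le> a ! j" "b ! Suc i \<le> b ! j"
    using assms by (metis Suc_lessI eq_imp_le less_imp_le nth_less_of_sorted)+
  ultimately show ?thesis by simp
qed

lemma sorted_list_of_set_of_list:
  "sorted_wrt (<) (a::nat list) \<Longrightarrow> sorted_list_of_set (set a) = a"
  by (simp add: sorted_list_of_set.idem_if_sorted_distinct strict_sorted_iff)

lemma partite_pattern_lists:
  assumes "partite_pattern r P"
  obtains p q where "P = {set p, set q}" "length p = r" "length q = r"
    "sorted_wrt (<) p" "sorted_wrt (<) q" "interleaved p q" "\<forall>i<r. p ! i \<noteq> q ! i"
proof -
  have om: "ordered_matching r {1..2 * r} P" and cP: "card P = 2"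
    and part: "\<And>e i. e \<in> P \<Longrightarrow> i < r \<Longrightarrow> card (e \<inter> {i * 2 + 1..(i + 1) * 2}) = 1"
    using assms by (auto simp: partite_pattern_def is_pattern_def partite_matching_def)
  obtain e f where P: "P = {e, f}" "e \<noteq> f" using cP by (meson card_2_iff)
  \<comment> \<open>The vertices of \<open>e\<close> in increasing order: one from each interval \<open>{2 * i + 1, 2 * i + 2}\<close>.\<close>
  define pt where "pt e = map (\<lambda>i. the_elem (e \<inter> {i * 2 + 1..(i + 1) * 2})) [0..<r]" for e :: "nat set"
  have pt: "pt e ! i \<in> e" "2 * i + 1 \<le> pt e ! i" "pt e ! i \<le> 2 * i + 2" if ei: "e \<in> P" "i < r" for e i
  proof -
    obtain x where x: "e \<inter> {i * 2 + 1..(i + 1) * 2} = {x}"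
      using part[OF ei] by (meson card_1_singletonE)
    then have "pt e ! i = x" using ei by (simp add: pt_def)
    moreover have "x \<in> e \<inter> {i * 2 + 1..(i + 1) * 2}" using x by simp
    ultimately show "pt e ! i \<in> e" "2 * i + 1 \<le> pt e ! i" "pt e ! i \<le> 2 * i + 2" by auto
  qed
  have len: "length (pt e) = r" for e by (simp add: pt_def)
  have srt: "sorted_wrt (<) (pt e)" if "e \<in> P" for e
  proof -
    have "pt e ! i < pt e ! j" if "i < j" "j < r" for i j
      using pt[OF \<open>e \<in> P\<close>, of i] pt[OF \<open>e \<in> P\<close>, of j] that by linarith
    then show ?thesis by (simp add: sorted_wrt_iff_nth_less len)
  qed
  have set_pt: "set (pt e) = e" if "e \<in> P" for e
  proof (rule card_subset_eq)
    show "finite e" using that om by (meson finite_subset ordered_matching_def)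
    show "set (pt e) \<subseteq> e" using pt that len by (auto simp: in_set_conv_nth)
    have "distinct (pt e)" using srt[OF that] strict_sorted_iff by blast
    then show "card (set (pt e)) = card e"
      using that om by (simp add: distinct_card len ordered_matching_def)
  qed
  have disj: "e \<inter> f = {}"
  proof (rule ccontr)
    assume "e \<inter> f \<noteq> {}"
    then obtain v where v: "v \<in> e" "v \<in> f" by blast
    have "e \<in> P" "f \<in> P" using P by auto
    moreover from this have "v \<in> {1..2 * r}" using om v unfolding ordered_matching_def by blast
    ultimately show False using om v P(2) unfolding ordered_matching_def by blast
  qed
  show thesis
  proof (rule that[of "pt e" "pt f"])
    show "P = {set (pt e), set (pt f)}" using P set_pt by auto
    show "interleaved (pt e) (pt f)"
      unfolding interleaved_def
    proof (intro allI impI)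
      fix i assume "Suc i < length (pt e)"
      then show "max (pt e ! i) (pt f ! i) < min (pt e ! Suc i) (pt f ! Suc i)"
        using pt[of e i] pt[of f i] pt[of e "Suc i"] pt[of f "Suc i"] P len by auto
    qed
    show "\<forall>i<r. pt e ! i \<noteq> pt f ! i"
    proof (intro allI impI)
      fix i assume "i < r"
      then show "pt e ! i \<noteq> pt f ! i" using pt(1)[of e i] pt(1)[of f i] P disj by auto
    qed
  qed (use P len srt in auto)
qed

text \<open>
  The order of the $2r$ entries of two interleaved tuples is determined by $D$, so matching equal positions
  preserves it.
\<close>

lemma order_isomorphic_of_interleaved:
  fixes a b p q :: "nat list"
  assumes len: "length a = r" "length b = r" "length p = r" "length q = r"
    and srt: "sorted_wrt (<) a" "sorted_wrt (<) b" "sorted_wrt (<) p" "sorted_wrt (<) q"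
    and il: "interleaved a b" "interleaved p q"
    and op: "twisted_less D a b" "twisted_less D p q"
  shows "order_isomorphic {set a, set b} {set p, set q}"
proof -
  \<comment> \<open>Name the \<open>2 * r\<close> entries by pairs of a position and a tuple; the isomorphism transports along these names.\<close>
  define I where "I = {..<r} \<times> (UNIV :: bool set)"
  define u where "u = (\<lambda>(i, s). if s then a ! i else b ! i)"
  define w where "w = (\<lambda>(i, s). if s then p ! i else q ! i)"
  have lt: "u (i, s) < u (j, t)" "w (i, s) < w (j, t)" if "i < j" "j < r" for i j s t
    using interleaved_less[OF il(1) _ srt(1,2) that(1)] interleaved_less[OF il(2) _ srt(3,4) that(1)] that len
    by (auto simp: u_def w_def)
  have same: "u (i, s) < u (i, t) \<longleftrightarrow> w (i, s) < w (i, t)" if "i < r" for i s t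
    using op that len unfolding twisted_less_def u_def w_def
    by (cases s; cases t) (auto split: if_splits dest: less_asym)
  have mono: "w x < w y" if "x \<in> I" "y \<in> I" "u x < u y" for x y
  proof -
    obtain i s j t where xy: "x = (i, s)" "y = (j, t)" by fastforce
    then have ij: "i < r" "j < r" using that by (auto simp: I_def)
    consider "i < j" | "i = j" | "j < i" by linarith
    then show ?thesis
      using that(3) lt(1)[of j i t s] lt(2)[of i j s t] same[of i s t] ij xy by cases auto
  qed
  have "u x \<noteq> u y" if "x \<in> I" "y \<in> I" "x \<noteq> y" for x y
  proof -
    obtain i s j t where xy: "x = (i, s)" "y = (j, t)" by fastforce
    then have ij: "i < r" "j < r" using that by (auto simp: I_def)
    have "u (i, s) < u (i, t) \<or> u (i, t) < u (i, s)" if "s \<noteq> t"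
      using op(1) ij(1) len(1) that unfolding twisted_less_def u_def
      by (cases s; cases t) (auto split: if_splits)
    then show ?thesis
      using lt(1)[of j i t s] lt(1)[of i j s t] ij xy that by (cases i j rule: linorder_cases) auto
  qed
  then have inj: "inj_on u I" by (meson inj_onI)
  define \<phi> where "\<phi> = w \<circ> inv_into I u"
  have \<phi>: "\<phi> (u x) = w x" if "x \<in> I" for x using inj that by (simp add: \<phi>_def)
  have sets: "set a = u ` ({..<r} \<times> {True})" "set b = u ` ({..<r} \<times> {False})"
    "set p = w ` ({..<r} \<times> {True})" "set q = w ` ({..<r} \<times> {False})"
    using len by (force simp: u_def w_def in_set_conv_nth)+
  have im: "\<phi> ` u ` X = w ` X" if "X \<subseteq> I" for X
    using \<phi> that by (force simp: image_iff subset_iff)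
  have "\<phi> ` set a = set p" "\<phi> ` set b = set q"
    unfolding sets by (rule im; auto simp: I_def)+
  moreover have "strict_mono_on (\<Union>{set a, set b}) \<phi>"
  proof (rule strict_mono_onI)
    fix v z assume vz: "v \<in> \<Union>{set a, set b}" "z \<in> \<Union>{set a, set b}" "v < z"
    have sub: "\<Union>{set a, set b} \<subseteq> u ` I" unfolding sets by (auto simp: I_def)
    obtain x where "x \<in> I" "v = u x" using subsetD[OF sub vz(1)] by (rule imageE)
    moreover obtain y where "y \<in> I" "z = u y" using subsetD[OF sub vz(2)] by (rule imageE)
    ultimately show "\<phi> v < \<phi> z" using mono[of x y] \<phi>[of x] \<phi>[of y] vz(3) by simp
  qed
  ultimately show ?thesis unfolding order_isomorphic_def by (intro exI[of _ \<phi>]) simp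
qed

text \<open>
  An order isomorphism preserves positions within an edge, but it may exchange the two edges, hence
  the disjunction.
\<close>

lemma twisted_less_of_order_isomorphic:
  fixes a b p q :: "nat list"
  assumes len: "length a = r" "length b = r" "length p = r" "length q = r"
    and srt: "sorted_wrt (<) a" "sorted_wrt (<) b" "sorted_wrt (<) p" "sorted_wrt (<) q"
    and op: "twisted_less D p q"
    and iso: "order_isomorphic {set a, set b} {set p, set q}"
  shows "twisted_less D a b \<or> twisted_less D b a"
proof -
  obtain \<phi> where \<phi>: "strict_mono_on (set a \<union> set b) \<phi>" "{\<phi> ` set a, \<phi> ` set b} = {set p, set q}"
    using iso unfolding order_isomorphic_def by auto
  have lt: "x < y" if "\<phi> x < \<phi> y" "x \<in> set a \<union> set b" "y \<in> set a \<union> set b" for x y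
    using \<phi>(1) that by (metis strict_mono_on_less)
  have srt\<phi>: "sorted_wrt (<) (map \<phi> c)" if "sorted_wrt (<) c" "set c \<subseteq> set a \<union> set b" for c
    unfolding sorted_wrt_map
  proof (rule sorted_wrt_mono_rel[OF _ that(1)])
    fix x y assume "x \<in> set c" "y \<in> set c" "x < y"
    then show "\<phi> x < \<phi> y" using that(2) by (intro strict_mono_onD[OF \<phi>(1)]) auto
  qed
  have eq: "map \<phi> c = d" if "\<phi> ` set c = set d" "sorted_wrt (<) c" "set c \<subseteq> set a \<union> set b" "sorted_wrt (<) d"
    for c d
  proof -
    have "map \<phi> c = sorted_list_of_set (set (map \<phi> c))"
      using sorted_list_of_set_of_list[OF srt\<phi>[OF that(2,3)]] by (rule sym)
    also have "\<dots> = d" using sorted_list_of_set_of_list[OF that(4)] by (simp only: set_map that(1))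
    finally show ?thesis .
  qed
  have "(map \<phi> a = p \<and> map \<phi> b = q) \<or> (map \<phi> a = q \<and> map \<phi> b = p)"
  proof -
    have "(\<phi> ` set a = set p \<and> \<phi> ` set b = set q) \<or> (\<phi> ` set a = set q \<and> \<phi> ` set b = set p)"
      using \<phi>(2) by (simp only: doubleton_eq_iff)
    then show ?thesis
      using eq[OF _ srt(1) _ srt(3)] eq[OF _ srt(2) _ srt(4)] eq[OF _ srt(1) _ srt(4)] eq[OF _ srt(2) _ srt(3)]
      by blast
  qed
  then show ?thesis
  proof (elim disjE conjE)
    assume pq: "map \<phi> a = p" "map \<phi> b = q"
    have "twisted_less D a b"
      unfolding twisted_less_def
    proof (intro allI impI)
      fix i assume "i < length a"
      then have i: "i < r" using len by simp
      then have eq: "p ! i = \<phi> (a ! i)" "q ! i = \<phi> (b ! i)" and mem: "a ! i \<in> set a" "b ! i \<in> set b"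
        using len unfolding pq[symmetric] by auto
      have "if i \<in> D then p ! i < q ! i else q ! i < p ! i"
        using op i len unfolding twisted_less_def by simp
      then show "if i \<in> D then a ! i < b ! i else b ! i < a ! i"
        using lt[of "a ! i" "b ! i"] lt[of "b ! i" "a ! i"] mem unfolding eq by auto
    qed
    then show ?thesis ..
  next
    assume pq: "map \<phi> a = q" "map \<phi> b = p"
    have "twisted_less D b a"
      unfolding twisted_less_def
    proof (intro allI impI)
      fix i assume "i < length b"
      then have i: "i < r" using len by simp
      then have eq: "q ! i = \<phi> (a ! i)" "p ! i = \<phi> (b ! i)" and mem: "a ! i \<in> set a" "b ! i \<in> set b"
        using len unfolding pq[symmetric] by auto
      have "if i \<in> D then p ! i < q ! i else q ! i < p ! i"
        using op i len unfolding twisted_less_def by simp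
      then show "if i \<in> D then b ! i < a ! i else a ! i < b ! i"
        using lt[of "a ! i" "b ! i"] lt[of "b ! i" "a ! i"] mem unfolding eq by auto
    qed
    then show ?thesis ..
  qed
qed

text \<open>
  From here on a partite pattern enters only through its set $D$. The first property, that interleaved tuples
  in the twisted order give a copy of $P$, serves the upper bound; the second, that any
  copy of $P$ is comparable in the twisted order, serves the lower bound.
\<close>

lemma partite_pattern_signs:
  assumes "partite_pattern r P"
  obtains D where
    "\<And>a b. length a = r \<Longrightarrow> length b = r \<Longrightarrow> sorted_wrt (<) a \<Longrightarrow> sorted_wrt (<) b \<Longrightarrow>
       twisted_less D a b \<Longrightarrow> interleaved a b \<Longrightarrow> order_isomorphic {set a, set b} P"
    "\<And>a b. length a = r \<Longrightarrow> length b = r \<Longrightarrow> sorted_wrt (<) a \<Longrightarrow> sorted_wrt (<) b \<Longrightarrow>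
       order_isomorphic {set a, set b} P \<Longrightarrow> twisted_less D a b \<or> twisted_less D b a"
proof -
  obtain p q where pq: "P = {set p, set q}" "length p = r" "length q = r"
    "sorted_wrt (<) p" "sorted_wrt (<) q" "interleaved p q" "\<forall>i<r. p ! i \<noteq> q ! i"
    by (rule partite_pattern_lists[OF assms])
  define D where "D = {i. p ! i < q ! i}"
  have op: "twisted_less D p q"
    unfolding twisted_less_def
  proof (intro allI impI)
    fix i assume "i < length p"
    then show "if i \<in> D then p ! i < q ! i else q ! i < p ! i"
      using pq(2,7) by (auto simp: D_def intro: le_neq_implies_less)
  qed
  show thesis
  proof (rule that[of D])
    fix a b :: "nat list"
    assume ab: "length a = r" "length b = r" "sorted_wrt (<) a" "sorted_wrt (<) b"
    show "order_isomorphic {set a, set b} P" if "twisted_less D a b" "interleaved a b"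
      using order_isomorphic_of_interleaved[OF ab(1,2) pq(2,3) ab(3,4) pq(4,5) that(2) pq(6) that(1) op] pq(1)
      by (simp only:)
    show "twisted_less D a b \<or> twisted_less D b a" if "order_isomorphic {set a, set b} P"
      using twisted_less_of_order_isomorphic[OF ab(1,2) pq(2,3) ab(3,4) pq(4,5) op] that pq(1) by (simp only:)
  qed
qed

section \<open>The upper bound in terms of cells\<close>

lemma card_ordered_matching:
  assumes "ordered_matching r {1..r * n} M" "r > 0"
  shows "card M = n"
proof -
  have edge: "\<And>e. e \<in> M \<Longrightarrow> e \<subseteq> {1..r * n} \<and> card e = r"
    and cover: "\<And>v. v \<in> {1..r * n} \<Longrightarrow> \<exists>!e. e \<in> M \<and> v \<in> e"
    using assms by (auto simp: ordered_matching_def)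
  have "finite M" by (rule finite_subset[of _ "Pow {1..r * n}"]) (use edge in auto)
  have U: "\<Union>M = {1..r * n}"
  proof
    show "\<Union>M \<subseteq> {1..r * n}" using edge by (simp add: Union_least)
    show "{1..r * n} \<subseteq> \<Union>M" using cover by (meson UnionI subsetI)
  qed
  have "r * card M = card (\<Union>M)"
  proof (rule card_partition[OF \<open>finite M\<close>])
    show "finite (\<Union>M)" using U by simp
    show "card e = r" if "e \<in> M" for e using edge that by blast
    show "e \<inter> f = {}" if ef: "e \<in> M" "f \<in> M" "e \<noteq> f" for e f
    proof (rule ccontr)
      assume "e \<inter> f \<noteq> {}"
      then obtain v where v: "v \<in> e" "v \<in> f" by blast
      then have "v \<in> {1..r * n}" using edge ef by blast
      then show False using cover[of v] v ef by blast
    qed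
  qed
  then show ?thesis using U \<open>r > 0\<close> by simp
qed

lemma avoids_of_pattern_free:
  assumes "ordered_matching r V M" "pattern_free P M" "r > 0"
    and iso: "\<And>a b. length a = r \<Longrightarrow> length b = r \<Longrightarrow> sorted_wrt (<) a \<Longrightarrow> sorted_wrt (<) b \<Longrightarrow>
       twisted_less D a b \<Longrightarrow> interleaved a b \<Longrightarrow> order_isomorphic {set a, set b} P"
  shows "avoids D (sorted_list_of_set ` M)"
  unfolding avoids_def
proof (intro ballI notI)
  fix a b assume "a \<in> sorted_list_of_set ` M" "b \<in> sorted_list_of_set ` M"
  then obtain e f where ef: "e \<in> M" "f \<in> M" "a = sorted_list_of_set e" "b = sorted_list_of_set f"
    by blast
  have fin: "finite e" "finite f" and card: "card e = r" "card f = r"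
    using assms(1) ef by (meson finite_subset ordered_matching_def)+
  have ab: "length a = r" "length b = r" "sorted_wrt (<) a" "sorted_wrt (<) b" "set a = e" "set b = f"
    using ef fin card by simp_all
  assume op: "twisted_less D a b \<and> interleaved a b"
  have "e \<noteq> f"
  proof
    assume "e = f"
    then have "twisted_less D a a" using op ef by simp
    then show False using ab(1) \<open>r > 0\<close> by (auto simp: twisted_less_def split: if_splits)
  qed
  moreover have "order_isomorphic {e, f} P" using iso[OF ab(1-4)] op ab(5,6) by simp
  ultimately show False using assms(2) ef by (auto simp: pattern_free_def)
qed

lemma card_edges_in_cells:
  assumes "finite S" "L > 0"
  shows "finite {e. finite e \<and> card e = r \<and> coarsen L (sorted_list_of_set e) \<in> S} \<and>
    card {e. finite e \<and> card e = r \<and> coarsen L (sorted_list_of_set e) \<in> S} \<le> card S * L ^ r"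
proof -
  let ?E = "{e. finite e \<and> card e = r \<and> coarsen L (sorted_list_of_set e) \<in> S}"
  let ?F = "\<lambda>c. {a. length a = r \<and> coarsen L a = c}"
  have inj: "inj_on sorted_list_of_set ?E"
    by (rule inj_onI) (metis (mono_tags, lifting) mem_Collect_eq set_sorted_list_of_set)
  have sub: "sorted_list_of_set ` ?E \<subseteq> (\<Union>c\<in>S. ?F c)" by auto
  have fin: "finite (\<Union>c\<in>S. ?F c)" using assms card_coarsen_fiber[of L r] by blast
  have "card ?E \<le> card (\<Union>c\<in>S. ?F c)" by (rule card_inj_on_le[OF inj sub fin])
  also have "\<dots> \<le> (\<Sum>c\<in>S. card (?F c))" using assms(1) by (rule card_UN_le)
  also have "\<dots> \<le> card S * L ^ r"
    using sum_bounded_above[of S "\<lambda>c. card (?F c)" "L ^ r"] card_coarsen_fiber[OF assms(2)] by simp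
  finally show ?thesis using inj_on_finite[OF inj sub fin] by blast
qed

text \<open>
  A matching is encoded by the family of cells that its edges meet, followed by a choice of $n$ of the at
  most $X$ edges that lie in these cells. Multiplying by $n!$ turns the binomial coefficient into the
  power $X^n$.
\<close>

lemma num_pattern_free_upper_nat:
  assumes P: "partite_pattern r P" and r: "r \<ge> 2" and L: "r * n < L * 2 ^ t"
  shows "num_pattern_free r P n * fact n
    \<le> 2 ^ (2 ^ r * (2 * r) * 2 ^ (t * (r - 1))) * (2 * r * 2 ^ (t * (r - 1)) * L ^ r) ^ n"
proof -
  obtain D where D: "\<And>a b. length a = r \<Longrightarrow> length b = r \<Longrightarrow> sorted_wrt (<) a \<Longrightarrow> sorted_wrt (<) b \<Longrightarrow>
       twisted_less D a b \<Longrightarrow> interleaved a b \<Longrightarrow> order_isomorphic {set a, set b} P"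
    by (rule partite_pattern_signs[OF P]) blast
  let ?A = "{M. ordered_matching r {1..r * n} M \<and> pattern_free P M}"
  let ?B = "avoiding_families D r (2 ^ t)"
  define X where "X = 2 * r * 2 ^ (t * (r - 1)) * L ^ r"
  define cell where "cell = (\<lambda>M. coarsen L ` sorted_list_of_set ` (M :: nat set set))"
  have "L > 0" using L by (cases L) auto
  have "card ?A \<le> card ?B * (X choose n)"
  proof (rule card_le_fibers[OF finite_avoiding_families, of cell])
    show "cell ` ?A \<subseteq> ?B"
    proof (rule image_subsetI)
      fix M assume "M \<in> ?A"
      then have M: "ordered_matching r {1..r * n} M" "pattern_free P M" by auto
      have "sorted_list_of_set ` M \<subseteq> {a. length a = r \<and> sorted a \<and> set a \<subseteq> {..<L * 2 ^ t}}"
      proof (rule image_subsetI)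
        fix e assume "e \<in> M"
        then have "e \<subseteq> {1..r * n}" "card e = r" using M by (auto simp: ordered_matching_def)
        moreover from this have "finite e" by (meson finite_atLeastAtMost finite_subset)
        ultimately show "sorted_list_of_set e \<in> {a. length a = r \<and> sorted a \<and> set a \<subseteq> {..<L * 2 ^ t}}"
          using L by auto
      qed
      moreover have "avoids D (sorted_list_of_set ` M)"
      proof (rule avoids_of_pattern_free[OF M])
        show "r > 0" using r by simp
      qed (rule D; assumption)
      ultimately show "cell M \<in> ?B" unfolding cell_def by (rule coarsen_avoiding_families)
    qed
  next
    fix S assume S: "S \<in> ?B"
    let ?E = "{e. finite e \<and> card e = r \<and> coarsen L (sorted_list_of_set e) \<in> S}"
    have finS: "finite S" using S finite_cells finite_subset by (auto simp: avoiding_families_def)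
    have "card S \<le> 2 * r * (2 ^ t) ^ (r - 1)"
      using S card_avoiding[of S r "2 ^ t" D] by (auto simp: avoiding_families_def)
    then have cS: "card S \<le> 2 * r * 2 ^ (t * (r - 1))" by (simp add: power_mult)
    have E: "finite ?E" "card ?E \<le> X"
    proof -
      show "finite ?E" using card_edges_in_cells[OF finS \<open>L > 0\<close>] by blast
      have "card ?E \<le> card S * L ^ r" using card_edges_in_cells[OF finS \<open>L > 0\<close>] by blast
      also have "\<dots> \<le> X" unfolding X_def using cS by (rule mult_le_mono1)
      finally show "card ?E \<le> X" .
    qed
    have sub: "{M \<in> ?A. cell M = S} \<subseteq> {M. M \<subseteq> ?E \<and> card M = n}"
    proof (rule subsetI)
      fix M assume M: "M \<in> {M \<in> ?A. cell M = S}"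
      then have om: "ordered_matching r {1..r * n} M" by simp
      have "M \<subseteq> ?E"
      proof
        fix e assume e: "e \<in> M"
        then have "e \<subseteq> {1..r * n}" "card e = r" using om by (auto simp: ordered_matching_def)
        moreover from this have "finite e" by (meson finite_atLeastAtMost finite_subset)
        moreover have "coarsen L (sorted_list_of_set e) \<in> S" using M e by (auto simp: cell_def)
        ultimately show "e \<in> ?E" by simp
      qed
      moreover have "card M = n" using card_ordered_matching[OF om] r by simp
      ultimately show "M \<in> {M. M \<subseteq> ?E \<and> card M = n}" by simp
    qed
    have "finite {M. M \<subseteq> ?E \<and> card M = n}" using E(1) by simp
    then have "card {M \<in> ?A. cell M = S} \<le> card ?E choose n" "finite {M \<in> ?A. cell M = S}"
      using card_mono[OF _ sub] n_subsets[OF E(1)] finite_subset[OF sub] by metis+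
    moreover have "card ?E choose n \<le> X choose n" using E(2) by (rule binomial_right_mono)
    ultimately show "finite {M \<in> ?A. cell M = S} \<and> card {M \<in> ?A. cell M = S} \<le> X choose n"
      by linarith
  qed
  then have "num_pattern_free r P n * fact n \<le> card ?B * (X choose n) * fact n"
    unfolding num_pattern_free_def by (rule mult_le_mono1)
  also have "\<dots> = card ?B * ((X choose n) * fact n)" by simp
  also have "\<dots> \<le> 2 ^ (2 ^ r * (2 * r) * 2 ^ (t * (r - 1))) * X ^ n"
    by (rule mult_le_mono[OF card_avoiding_families[OF r] binomial_fact_pow])
  finally show ?thesis by (simp only: X_def)
qed

section \<open>Matchings from antichains\<close>

definition sorted_enums :: "'a set \<Rightarrow> ('a \<Rightarrow> nat) \<Rightarrow> 'a list set" where
  "sorted_enums A g = {ys \<in> permutations_of_set A. sorted (map g ys)}"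

text \<open>
  Reading the list from the left, the key of the next element tells from which class it comes, and it is the
  first unused element of that class.
\<close>

lemma eq_of_key_classes:
  assumes "map g xs = map g ys" "\<And>k. filter (\<lambda>x. g x = k) xs = filter (\<lambda>x. g x = k) ys"
  shows "xs = ys"
  using assms
proof (induction xs arbitrary: ys)
  case (Cons x xs)
  then obtain y zs where ys: "ys = y # zs" by (cases ys) auto
  have g: "g x = g y" "map g xs = map g zs" using Cons.prems(1) ys by auto
  have "x = y" using Cons.prems(2)[of "g x"] g by (simp add: ys)
  moreover have "filter (\<lambda>z. g z = k) xs = filter (\<lambda>z. g z = k) zs" for k
    using Cons.prems(2)[of k] g \<open>x = y\<close> by (simp add: ys split: if_splits)
  ultimately show ?case using Cons.IH g ys by simp
qed simp

text \<open>
  Stable sorting by $g$ keeps the order inside each key class, so an enumeration of $A$ is recovered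
  from its sorted version together with its word of keys, of which there are at most $K^{|A|}$.
\<close>

lemma card_sorted_enums:
  assumes "finite A" "\<And>x. x \<in> A \<Longrightarrow> g x < K"
  shows "fact (card A) \<le> K ^ card A * card (sorted_enums A g)"
proof -
  let ?W = "{w. set w \<subseteq> {..<K} \<and> length w = card A}"
  have "inj_on (\<lambda>xs. (map g xs, sort_key g xs)) (permutations_of_set A)"
    by (rule inj_onI) (metis eq_of_key_classes prod.inject sort_key_stable)
  moreover have "(\<lambda>xs. (map g xs, sort_key g xs)) ` permutations_of_set A \<subseteq> ?W \<times> sorted_enums A g"
    using assms(2) by (auto simp: sorted_enums_def permutations_of_set_def distinct_card)
  moreover have "finite (?W \<times> sorted_enums A g)"
    by (simp add: finite_lists_length_eq sorted_enums_def assms(1))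
  ultimately have "card (permutations_of_set A) \<le> card (?W \<times> sorted_enums A g)"
    by (rule card_inj_on_le)
  then show ?thesis
    by (simp add: card_cartesian_product card_lists_length_eq card_permutations_of_set[OF assms(1)])
qed

definition pos :: "'a list \<Rightarrow> 'a \<Rightarrow> nat" where
  "pos ys = inv_into {..<length ys} ((!) ys)"

lemma pos_nth: "distinct ys \<Longrightarrow> j < length ys \<Longrightarrow> pos ys (ys ! j) = j"
  unfolding pos_def by (intro inv_into_f_f inj_on_nth) auto

lemma nth_pos: "x \<in> set ys \<Longrightarrow> ys ! pos ys x = x"
  unfolding pos_def by (rule f_inv_into_f) (auto simp: in_set_conv_nth)

lemma pos_less: "x \<in> set ys \<Longrightarrow> pos ys x < length ys"
  using inv_into_into[of x "(!) ys" "{..<length ys}"] by (force simp: pos_def in_set_conv_nth)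

text \<open>
  Coordinate $i$ uses the interval $\{in+1, \dots, (i+1)n\}$, and the places in a list start at $0$.
\<close>

definition edge_of :: "nat \<Rightarrow> nat \<Rightarrow> (nat \<Rightarrow> 'a list) \<Rightarrow> 'a \<Rightarrow> nat list" where
  "edge_of r n ys c = map (\<lambda>i. i * n + 1 + pos (ys i) c) [0..<r]"

lemma block_position_unique:
  fixes n :: nat
  assumes "i * n + 1 + j = i' * n + 1 + j'" "j < n" "j' < n"
  shows "i = i' \<and> j = j'"
proof -
  have "(i * n + j) div n = (i' * n + j') div n" "(i * n + j) mod n = (i' * n + j') mod n"
    using assms by simp_all
  then show ?thesis using assms by simp
qed

context
  fixes r n :: nat and D :: "nat set" and A :: "nat list set"
  assumes fin: "finite A" and card_A: "card A = n" and len_A: "\<And>c. c \<in> A \<Longrightarrow> length c = r"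
begin

text \<open>
  The coordinates are independent: the list in coordinate $i$ only has to be sorted by the
  $i$-th entries of the tuples.
\<close>

definition arrangements :: "(nat \<Rightarrow> nat list list) set" where
  "arrangements = (\<Pi>\<^sub>E i\<in>{..<r}. sorted_enums A (\<lambda>c. c ! i))"

lemma arrangement_nth:
  assumes "ys \<in> arrangements" "i < r"
  shows "distinct (ys i)" "set (ys i) = A" "length (ys i) = n" "sorted (map (\<lambda>c. c ! i) (ys i))"
proof -
  have "ys i \<in> sorted_enums A (\<lambda>c. c ! i)" using assms by (auto simp: arrangements_def)
  then show "distinct (ys i)" "set (ys i) = A" "sorted (map (\<lambda>c. c ! i) (ys i))"
    by (auto simp: sorted_enums_def permutations_of_set_def)
  then show "length (ys i) = n" using card_A distinct_card by fastforce
qed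

lemma edge_of_nth:
  "i < r \<Longrightarrow> edge_of r n ys c ! i = i * n + 1 + pos (ys i) c"
  by (simp add: edge_of_def)

lemma length_edge_of: "length (edge_of r n ys c) = r"
  by (simp add: edge_of_def)

lemma arrangement_pos:
  assumes "ys \<in> arrangements" "i < r" "c \<in> A"
  shows "pos (ys i) c < n" "ys i ! pos (ys i) c = c"
  using arrangement_nth[OF assms(1,2)] pos_less[of c "ys i"] nth_pos[of c "ys i"] assms(3) by auto

lemma sorted_edge_of:
  assumes "ys \<in> arrangements" "c \<in> A"
  shows "sorted_wrt (<) (edge_of r n ys c)"
  unfolding sorted_wrt_iff_nth_less
proof (intro allI impI)
  fix i j assume ij: "i < j" "j < length (edge_of r n ys c)"
  then have "j < r" by (simp add: length_edge_of)
  have "i * n + n \<le> j * n" using ij mult_le_mono1[of "Suc i" j n] by simp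
  then show "edge_of r n ys c ! i < edge_of r n ys c ! j"
    using arrangement_pos(1)[OF assms(1) _ assms(2), of i] ij \<open>j < r\<close> by (simp add: edge_of_nth)
qed

lemma mem_edge_of:
  assumes "ys \<in> arrangements" "c \<in> A" "i < r" "j < n"
  shows "i * n + 1 + j \<in> set (edge_of r n ys c) \<longleftrightarrow> c = ys i ! j"
proof
  assume "i * n + 1 + j \<in> set (edge_of r n ys c)"
  then obtain i' where i': "i' < r" "i * n + 1 + j = i' * n + 1 + pos (ys i') c"
    by (auto simp: edge_of_def)
  then have "i = i' \<and> j = pos (ys i') c"
    using block_position_unique assms(4) arrangement_pos(1)[OF assms(1) i'(1) assms(2)] by blast
  then show "c = ys i ! j" using arrangement_pos(2)[OF assms(1) i'(1) assms(2)] by simp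
next
  assume "c = ys i ! j"
  then have "pos (ys i) c = j" using arrangement_nth[OF assms(1,3)] assms(4) by (simp add: pos_nth)
  then show "i * n + 1 + j \<in> set (edge_of r n ys c)" using assms(3) by (force simp: edge_of_def)
qed

definition matching_of :: "(nat \<Rightarrow> nat list list) \<Rightarrow> nat set set" where
  "matching_of ys = (\<lambda>c. set (edge_of r n ys c)) ` A"

lemma ordered_matching_of:
  assumes ys: "ys \<in> arrangements"
  shows "ordered_matching r {1..r * n} (matching_of ys)"
  unfolding ordered_matching_def
proof (intro conjI ballI)
  fix e assume "e \<in> matching_of ys"
  then obtain c where c: "c \<in> A" "e = set (edge_of r n ys c)" by (auto simp: matching_of_def)
  have "i * n + 1 + pos (ys i) c \<in> {1..r * n}" if "i < r" for i
    using arrangement_pos(1)[OF ys that c(1)] mult_le_mono1[of "Suc i" r n] that by simp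
  then show "e \<subseteq> {1..r * n}" unfolding c(2) edge_of_def by auto
  have "distinct (edge_of r n ys c)" using sorted_edge_of[OF ys c(1)] strict_sorted_iff by blast
  then show "card e = r" using c(2) distinct_card length_edge_of by metis
next
  fix v assume v: "v \<in> {1..r * n}"
  then have "n > 0" by (cases n) auto
  define i j where "i = (v - 1) div n" and "j = (v - 1) mod n"
  have vij: "v = i * n + 1 + j" using v by (simp add: i_def j_def)
  have "i < r" using v unfolding i_def by (auto simp: less_mult_imp_div_less)
  have "j < n" using \<open>n > 0\<close> by (simp add: j_def)
  have c: "ys i ! j \<in> A" using arrangement_nth[OF ys \<open>i < r\<close>] \<open>j < n\<close> by (metis nth_mem)
  note mem = mem_edge_of[OF ys _ \<open>i < r\<close> \<open>j < n\<close>, folded vij]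
  show "\<exists>!e. e \<in> matching_of ys \<and> v \<in> e"
  proof (rule ex1I[of _ "set (edge_of r n ys (ys i ! j))"])
    show "set (edge_of r n ys (ys i ! j)) \<in> matching_of ys \<and> v \<in> set (edge_of r n ys (ys i ! j))"
      using c mem[OF c] by (auto simp: matching_of_def)
  next
    fix e assume "e \<in> matching_of ys \<and> v \<in> e"
    then show "e = set (edge_of r n ys (ys i ! j))" using mem by (auto simp: matching_of_def)
  qed
qed simp

lemma nth_le_of_pos_less:
  assumes "ys \<in> arrangements" "i < r" "c \<in> A" "d \<in> A" "pos (ys i) c < pos (ys i) d"
  shows "c ! i \<le> d ! i"
proof -
  note c = arrangement_pos[OF assms(1,2,3)] and d = arrangement_pos[OF assms(1,2,4)]
  have "map (\<lambda>c. c ! i) (ys i) ! pos (ys i) c \<le> map (\<lambda>c. c ! i) (ys i) ! pos (ys i) d"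
    using arrangement_nth[OF assms(1,2)] assms(5) d(1) by (intro sorted_nth_mono) auto
  then show ?thesis using c d arrangement_nth(3)[OF assms(1,2)] by simp
qed

text \<open>
  All arrangements give the same sorted sequence of labels in coordinate $l$, because this is
  the sorted multiset of the entries $c_l$ for $c \in A$. Hence the places of the vertices of an edge
  reveal all entries of its tuple, so the matching determines which tuple stands at each place.
\<close>

lemma inj_on_matching_of: "inj_on matching_of arrangements"
proof (rule inj_onI)
  fix ys zs assume ys: "ys \<in> arrangements" and zs: "zs \<in> arrangements"
    and eq: "matching_of ys = matching_of zs"
  have labels: "map (\<lambda>c. c ! l) (ys l) = map (\<lambda>c. c ! l) (zs l)" if "l < r" for l
  proof -
    note y = arrangement_nth[OF ys that] and z = arrangement_nth[OF zs that]
    have "mset (ys l) = mset (zs l)" using y(1,2) z(1,2) by (metis mset_set_set)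
    then have "mset (map (\<lambda>c. c ! l) (ys l)) = mset (map (\<lambda>c. c ! l) (zs l))" by simp
    then show ?thesis using y(4) z(4) by (metis properties_for_sort)
  qed
  have "ys i ! j = zs i ! j" if "i < r" "j < n" for i j
  proof -
    define c where "c = ys i ! j"
    have c: "c \<in> A" using arrangement_nth[OF ys \<open>i < r\<close>] that by (metis c_def nth_mem)
    then obtain d where d: "d \<in> A" "set (edge_of r n ys c) = set (edge_of r n zs d)"
    proof -
      have "set (edge_of r n ys c) \<in> matching_of zs"
        using c unfolding eq[symmetric] by (simp add: matching_of_def)
      then show ?thesis using that by (auto simp: matching_of_def)
    qed
    have same: "edge_of r n ys c = edge_of r n zs d"
      using sorted_list_of_set_of_list[OF sorted_edge_of[OF ys c]]
        sorted_list_of_set_of_list[OF sorted_edge_of[OF zs d(1)]] d(2) by metis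
    have pos: "pos (ys l) c = pos (zs l) d" if "l < r" for l
      using edge_of_nth[OF that, of ys c] edge_of_nth[OF that, of zs d] same by simp
    have "c = d"
    proof (rule nth_equalityI)
      show "length c = length d" using len_A c d by simp
      fix l assume "l < length c"
      then have l: "l < r" using len_A c by simp
      note yl = arrangement_pos[OF ys l c] and zl = arrangement_pos[OF zs l d(1)]
      have "map (\<lambda>c. c ! l) (ys l) ! pos (ys l) c = map (\<lambda>c. c ! l) (zs l) ! pos (zs l) d"
        using labels[OF l] pos[OF l] by simp
      then show "c ! l = d ! l"
        using yl zl arrangement_nth(3)[OF ys l] arrangement_nth(3)[OF zs l] by simp
    qed
    moreover have "pos (ys i) c = j"
      using arrangement_nth[OF ys \<open>i < r\<close>] that by (simp add: c_def pos_nth)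
    ultimately show ?thesis
      using arrangement_pos(2)[OF zs \<open>i < r\<close> d(1)] pos[OF \<open>i < r\<close>] c_def by simp
  qed
  then have "ys i = zs i" if "i < r" for i
    using arrangement_nth(3)[OF ys that] arrangement_nth(3)[OF zs that] that by (intro nth_equalityI) auto
  then show "ys = zs"
    using ys zs unfolding arrangements_def by (intro PiE_ext[of ys "{..<r}" _ zs]) auto
qed

text \<open>
  A copy of the pattern makes two edges comparable in the twisted order of places; as the lists are
  sorted, their tuples are then weakly comparable, which an antichain excludes.
\<close>

lemma pattern_free_matching_of:
  assumes ys: "ys \<in> arrangements"
    and anti: "\<And>c d. c \<in> A \<Longrightarrow> d \<in> A \<Longrightarrow> c \<noteq> d \<Longrightarrow>
      \<exists>i<r. \<not> (if i \<in> D then c ! i \<le> d ! i else d ! i \<le> c ! i)"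
    and iso: "\<And>a b. length a = r \<Longrightarrow> length b = r \<Longrightarrow> sorted_wrt (<) a \<Longrightarrow> sorted_wrt (<) b \<Longrightarrow>
       order_isomorphic {set a, set b} P \<Longrightarrow> twisted_less D a b \<or> twisted_less D b a"
  shows "pattern_free P (matching_of ys)"
  unfolding pattern_free_def
proof (rule notI, elim bexE conjE)
  have not_twisted_less: False if cd: "c \<in> A" "d \<in> A" "c \<noteq> d" and op: "twisted_less D (edge_of r n ys c) (edge_of r n ys d)" for c d
  proof -
    obtain i where i: "i < r" "\<not> (if i \<in> D then c ! i \<le> d ! i else d ! i \<le> c ! i)"
      using anti[OF cd] by blast
    have "if i \<in> D then pos (ys i) c < pos (ys i) d else pos (ys i) d < pos (ys i) c"
      using op[unfolded twisted_less_def length_edge_of, rule_format, OF i(1)]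
      by (cases "i \<in> D") (simp_all add: edge_of_nth[OF i(1)])
    then show False
      using nth_le_of_pos_less[OF ys i(1)] cd i(2) by (auto split: if_splits)
  qed
  fix e f
  assume ef: "e \<in> matching_of ys" "f \<in> matching_of ys" "e \<noteq> f" "order_isomorphic {e, f} P"
  obtain c where c: "c \<in> A" "e = set (edge_of r n ys c)" using ef(1) unfolding matching_of_def by blast
  obtain d where d: "d \<in> A" "f = set (edge_of r n ys d)" using ef(2) unfolding matching_of_def by blast
  have "c \<noteq> d" using ef(3) c d by blast
  have "twisted_less D (edge_of r n ys c) (edge_of r n ys d) \<or> twisted_less D (edge_of r n ys d) (edge_of r n ys c)"
    using ef(4) unfolding c(2) d(2)
    by (rule iso[OF length_edge_of length_edge_of sorted_edge_of[OF ys c(1)] sorted_edge_of[OF ys d(1)]])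
  then show False
    using not_twisted_less[OF c(1) d(1) \<open>c \<noteq> d\<close>] not_twisted_less[OF d(1) c(1) \<open>c \<noteq> d\<close>[symmetric]] by blast
qed

lemma card_arrangements:
  assumes "\<And>c i. c \<in> A \<Longrightarrow> i < r \<Longrightarrow> c ! i < K"
  shows "fact n ^ r \<le> (K ^ n) ^ r * card arrangements"
proof -
  have "(\<Prod>i<r. fact n) \<le> (\<Prod>i<r. K ^ n * card (sorted_enums A (\<lambda>c. c ! i)))"
    using card_sorted_enums[OF fin, of "\<lambda>c. c ! _" K] assms card_A by (intro prod_mono) auto
  then show ?thesis
    by (simp add: arrangements_def card_PiE prod.distrib)
qed

end

text \<open>
  The first $r-1$ entries are free in $[k]$, and the last one is chosen such that a signed sum of all entries
  is constant. Two comparable tuples then agree in every term of the sum.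
\<close>

lemma exists_antichain:
  assumes "n \<le> k ^ (r - 1)" "r \<ge> 2"
  obtains A where "finite A" "card A = n" "\<And>c. c \<in> A \<Longrightarrow> length c = r"
    "\<And>c i. c \<in> A \<Longrightarrow> i < r \<Longrightarrow> c ! i < r * k + 1"
    "\<And>c d. c \<in> A \<Longrightarrow> d \<in> A \<Longrightarrow> c \<noteq> d \<Longrightarrow>
      \<exists>i<r. \<not> (if i \<in> D then c ! i \<le> d ! i else d ! i \<le> c ! i)"
proof -
  define s where "s = r - 1"
  have r: "r = Suc s" using assms by (simp add: s_def)
  let ?T = "{a. set a \<subseteq> {..<k} \<and> length a = s}"
  \<comment> \<open>Reflecting the coordinates outside \<open>D\<close> turns the twisted order into the usual one.\<close>
  define h where "h i x = (if i \<in> D then x else k - 1 - x)" for i x :: nat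
  define w where "w a = (\<Sum>i<s. h i (a ! i))" for a
  \<comment> \<open>No weight exceeds \<open>r * k\<close>, so the subtraction does not truncate.\<close>
  define ext where "ext a = a @ [if s \<in> D then r * k - w a else w a]" for a
  have "n \<le> card ?T" using assms(1) by (simp add: card_lists_length_eq s_def)
  then obtain T where T: "T \<subseteq> ?T" "card T = n" "finite T" by (rule obtain_subset_with_card_n)
  have len: "length a = s" if "a \<in> T" for a using T(1) that by auto
  have ltk: "a ! i < k" if "a \<in> T" "i < s" for a i using T(1) that by (auto simp: subset_iff)
  have w_le: "w a \<le> r * k" if "a \<in> T" for a
  proof -
    have "w a \<le> (\<Sum>i<s. k)" unfolding w_def
      by (intro sum_mono) (use ltk[OF that] in \<open>auto simp: h_def less_imp_le\<close>)
    then show ?thesis by (simp add: r)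
  qed
  have nth_ext: "ext a ! i = a ! i" if "a \<in> T" "i < s" for a i
    using that len by (simp add: ext_def nth_append)
  have last_ext: "ext a ! s = (if s \<in> D then r * k - w a else w a)" if "a \<in> T" for a
    using that len by (simp add: ext_def nth_append)
  show thesis
  proof (rule that[of "ext ` T"])
    show "finite (ext ` T)" using T by simp
    have "inj_on ext T" by (auto simp: inj_on_def ext_def)
    then show "card (ext ` T) = n" using T card_image by blast
    show "length c = r" if "c \<in> ext ` T" for c using that len by (auto simp: ext_def r)
    show "c ! i < r * k + 1" if ci: "c \<in> ext ` T" "i < r" for c i
    proof -
      obtain a where a: "a \<in> T" "c = ext a" using ci by blast
      show ?thesis
      proof (cases "i < s")
        case True
        then show ?thesis using ltk[OF a(1) True] nth_ext[OF a(1) True] a(2) by (simp add: r)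
      next
        case False
        then have "i = s" using ci r by simp
        then show ?thesis using last_ext[OF a(1)] w_le[OF a(1)] a(2) by (simp add: less_Suc_eq_le)
      qed
    qed
    show "\<exists>i<r. \<not> (if i \<in> D then c ! i \<le> d ! i else d ! i \<le> c ! i)"
      if cd: "c \<in> ext ` T" "d \<in> ext ` T" "c \<noteq> d" for c d
    proof (rule ccontr)
      assume "\<not> ?thesis"
      then have le: "if i \<in> D then c ! i \<le> d ! i else d ! i \<le> c ! i" if "i < r" for i using that by blast
      obtain a b where ab: "a \<in> T" "b \<in> T" "c = ext a" "d = ext b" using cd by blast
      have hle: "h i (a ! i) \<le> h i (b ! i)" if "i < s" for i
        using le[of i] that nth_ext[OF ab(1) that] nth_ext[OF ab(2) that] ab r
        by (auto simp: h_def split: if_splits)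
      then have "w a \<le> w b" unfolding w_def by (intro sum_mono) simp
      moreover have "w b \<le> w a"
        using le[of s] last_ext[OF ab(1)] last_ext[OF ab(2)] w_le[OF ab(1)] w_le[OF ab(2)] ab r
        by (auto split: if_splits)
      ultimately have "w a = w b" by simp
      have "a ! i = b ! i" if "i < s" for i
      proof -
        have "h i (a ! i) = h i (b ! i)"
          using sum_mono_inv[of "\<lambda>i. h i (a ! i)" "{..<s}" "\<lambda>i. h i (b ! i)" i] \<open>w a = w b\<close> hle that
          by (simp add: w_def)
        then show ?thesis
          using ltk[OF ab(1) that] ltk[OF ab(2) that] by (auto simp: h_def split: if_splits)
      qed
      then have "a = b" using len ab by (intro nth_equalityI) auto
      then show False using ab cd by simp
    qed
  qed
qed

lemma num_pattern_free_lower_nat: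
  assumes P: "partite_pattern r P" and r: "r \<ge> 2" and k: "n \<le> k ^ (r - 1)"
  shows "fact n ^ r \<le> ((r * k + 1) ^ n) ^ r * num_pattern_free r P n"
proof -
  obtain D where D: "\<And>a b. length a = r \<Longrightarrow> length b = r \<Longrightarrow> sorted_wrt (<) a \<Longrightarrow> sorted_wrt (<) b \<Longrightarrow>
       order_isomorphic {set a, set b} P \<Longrightarrow> twisted_less D a b \<or> twisted_less D b a"
    by (rule partite_pattern_signs[OF P]) blast
  obtain A where A: "finite A" "card A = n" "\<And>c. c \<in> A \<Longrightarrow> length c = r"
    "\<And>c i. c \<in> A \<Longrightarrow> i < r \<Longrightarrow> c ! i < r * k + 1"
    "\<And>c d. c \<in> A \<Longrightarrow> d \<in> A \<Longrightarrow> c \<noteq> d \<Longrightarrow>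
      \<exists>i<r. \<not> (if i \<in> D then c ! i \<le> d ! i else d ! i \<le> c ! i)"
    using exists_antichain[OF k r] by metis
  have sub: "matching_of r n A ` arrangements r A \<subseteq> {M. ordered_matching r {1..r * n} M \<and> pattern_free P M}"
  proof (rule image_subsetI)
    fix ys assume ys: "ys \<in> arrangements r A"
    have "pattern_free P (matching_of r n A ys)"
      by (rule pattern_free_matching_of[OF A(1-3) ys A(5) D])
    then show "matching_of r n A ys \<in> {M. ordered_matching r {1..r * n} M \<and> pattern_free P M}"
      using ordered_matching_of[OF A(1-3) ys] by simp
  qed
  have "card (arrangements r A) \<le> num_pattern_free r P n"
    unfolding num_pattern_free_def
    by (rule card_inj_on_le[OF inj_on_matching_of[OF A(1-3)] sub finite_ordered_matchings])
  then show ?thesis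
    using card_arrangements[OF A(1-3) A(4)] by (meson dual_order.trans mult_le_mono2)
qed

section \<open>Asymptotics\<close>

lemma power_le_exp_fact: "real n ^ n \<le> exp (real n) * fact n"
proof -
  obtain t where t: "exp (real n) = (\<Sum>m<Suc n. real n ^ m / fact m) + exp t / fact (Suc n) * real n ^ Suc n"
    using Maclaurin_exp_le[of "real n" "Suc n"] by auto
  have "real n ^ n / fact n \<le> (\<Sum>m<Suc n. real n ^ m / fact m)"
    by (simp add: sum_nonneg)
  also have "\<dots> \<le> exp (real n)" unfolding t by simp
  finally show ?thesis by (simp add: field_simps)
qed

text \<open>
  With $m = n^{1/(r-1)}$ blocks per axis, an edge confined to one cell has $(n/m)^r$ positions; for
  $s = r-1$ this is $n$ to the power $(1 - 1/s) r = s - 1/s$.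
\<close>

lemma scale_power_eq:
  assumes "r \<ge> 2" "n > 0"
  shows "((real n / real n powr (1 / real (r - 1))) ^ r) ^ n
    = real n powr ((real r - 1 - 1 / (real r - 1)) * real n)"
proof -
  define s where "s = real r - 1"
  have s: "s \<ge> 1" "real (r - 1) = s" using assms by (auto simp: s_def of_nat_diff)
  have "real n / real n powr (1 / s) = real n powr (1 - 1 / s)"
    using assms by (simp add: powr_diff)
  moreover have "(real n powr c) ^ m = real n powr (c * real m)" for c m
    using assms by (simp add: powr_realpow[symmetric] powr_powr)
  ultimately have "((real n / real n powr (1 / s)) ^ r) ^ n = real n powr ((1 - 1 / s) * (real r * real n))"
    by (simp add: power_mult[symmetric] mult.assoc)
  also have "(1 - 1 / s) * (real r * real n) = (real r - 1 - 1 / (real r - 1)) * real n"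
  proof -
    have "(1 - 1 / s) * real r = s - 1 / s" using s(1) by (simp add: s_def field_simps)
    then show ?thesis by (simp add: s_def mult.assoc[symmetric])
  qed
  finally show ?thesis unfolding s(2) .
qed

text \<open>
  The resolution $2^t$ is the least power of two with $2^{t(r-1)} \ge n$. Minimality gives
  $2^{t(r-1)} \le 2^{r-1} n$, so the number of cells stays linear in $n$, while $2^t \ge n^{1/(r-1)}$ bounds
  the block length $L$.
\<close>

lemma num_pattern_free_upper:
  assumes P: "partite_pattern r P" and r: "r \<ge> 2" and n: "n > 0"
  shows "real (num_pattern_free r P n)
    \<le> (2 ^ (2 ^ r * (2 * r) * 2 ^ (r - 1)) * (2 * real r * 2 ^ (r - 1) * real (r + 1) ^ r) * exp 1) ^ n
        * real n powr ((real r - 1 - 1 / (real r - 1)) * real n)"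
proof -
  define x where "x = real n powr (1 / real (r - 1))"
  define B where "B = 2 ^ r * (2 * r)"
  have x1: "x \<ge> 1" using n by (simp add: x_def ge_one_powr_ge_zero)
  have xpow: "x ^ (r - 1) = real n"
    using n r by (simp add: x_def powr_realpow[symmetric] powr_powr)
  have xn: "x \<le> real n"
    using power_increasing[of 1 "r - 1" x] x1 r xpow by simp
  define t where "t = (LEAST t. n \<le> 2 ^ (t * (r - 1)))"
  have ex: "n \<le> 2 ^ (n * (r - 1))"
  proof -
    have "n \<le> 2 ^ n" by simp
    also have "\<dots> \<le> 2 ^ (n * (r - 1))" using r by (intro power_increasing) auto
    finally show ?thesis .
  qed
  have t: "n \<le> 2 ^ (t * (r - 1))" unfolding t_def by (rule LeastI, rule ex)
  have t': "2 ^ (t * (r - 1)) \<le> 2 ^ (r - 1) * n"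
  proof (cases t)
    case 0
    then show ?thesis using n by simp
  next
    case (Suc u)
    then have "\<not> n \<le> 2 ^ (u * (r - 1))" unfolding t_def by (metis lessI not_less_Least)
    then show ?thesis using Suc by (simp add: power_add)
  qed
  have x_le: "x \<le> 2 ^ t"
  proof (rule power_le_imp_le_base[of x "r - 2"])
    have "real n \<le> real (2 ^ (t * (r - 1)))" using t by (simp only: of_nat_le_iff)
    then have "x ^ (r - 1) \<le> (2 ^ t) ^ (r - 1)" using xpow by (simp add: power_mult)
    moreover have "Suc (r - 2) = r - 1" using r by simp
    ultimately show "x ^ Suc (r - 2) \<le> (2 ^ t) ^ Suc (r - 2)" by (simp only:)
  qed simp
  define L where "L = r * n div 2 ^ t + 1"
  have L: "r * n < L * 2 ^ t"
    unfolding L_def using dividend_less_div_times[of "2 ^ t" "r * n"] by (simp add: algebra_simps)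
  have L_le: "real L \<le> real (r + 1) * (real n / x)"
  proof -
    \<comment> \<open>The rounding error is at most \<open>1 \<le> n / x\<close>, which turns the factor \<open>r\<close> into \<open>r + 1\<close>.\<close>
    have "real (r * n div 2 ^ t) \<le> real (r * n) / real (2 ^ t)" by (rule of_nat_div_le_of_nat)
    also have "\<dots> \<le> real (r * n) / x" using x_le x1 by (intro divide_left_mono) auto
    finally have "real L \<le> real r * (real n / x) + 1" by (simp add: L_def)
    moreover have "1 \<le> real n / x" using x1 xn by simp
    ultimately have "real L \<le> real r * (real n / x) + real n / x" by linarith
    then show ?thesis by (simp only: of_nat_add of_nat_1 distrib_right mult_1_left)
  qed
  define y where "y = real n / x"
  have y0: "y \<ge> 0" using x1 by (simp add: y_def)
  define N where "N = real (num_pattern_free r P n)"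
  have "N * fact n \<le> 2 ^ (B * 2 ^ (t * (r - 1))) * (2 * real r * 2 ^ (t * (r - 1)) * real L ^ r) ^ n"
  proof -
    have "real (num_pattern_free r P n * fact n)
      \<le> real (2 ^ (B * 2 ^ (t * (r - 1))) * (2 * r * 2 ^ (t * (r - 1)) * L ^ r) ^ n)"
      using num_pattern_free_upper_nat[OF P r L] unfolding B_def of_nat_le_iff .
    then show ?thesis by (simp add: N_def)
  qed
  also have "\<dots> \<le> 2 ^ (B * (2 ^ (r - 1) * n)) * (2 * real r * (2 ^ (r - 1) * real n) * (real (r + 1) * y) ^ r) ^ n"
  proof (rule mult_mono)
    show "(2::real) ^ (B * 2 ^ (t * (r - 1))) \<le> 2 ^ (B * (2 ^ (r - 1) * n))"
      using t' by (intro power_increasing mult_le_mono) auto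
    have "real (2 ^ (t * (r - 1))) \<le> real (2 ^ (r - 1) * n)" using t' by (simp only: of_nat_le_iff)
    then show "(2 * real r * 2 ^ (t * (r - 1)) * real L ^ r) ^ n
      \<le> (2 * real r * (2 ^ (r - 1) * real n) * (real (r + 1) * y) ^ r) ^ n"
      using L_le y0 unfolding y_def[symmetric]
      by (intro power_mono mult_mono) (auto)
  qed auto
  also have "\<dots> = (2 ^ (B * 2 ^ (r - 1)) * (2 * real r * 2 ^ (r - 1) * real (r + 1) ^ r)) ^ n * (y ^ r) ^ n * real n ^ n"
    by (simp add: power_mult_distrib power_mult[symmetric] mult_ac)
  also have "\<dots> \<le> (2 ^ (B * 2 ^ (r - 1)) * (2 * real r * 2 ^ (r - 1) * real (r + 1) ^ r)) ^ n * (y ^ r) ^ n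
      * (exp (real n) * fact n)"
    using y0 by (intro mult_left_mono power_le_exp_fact) auto
  also have "exp (real n) = exp 1 ^ n" by (simp add: exp_of_nat_mult[symmetric])
  finally have "N * fact n \<le> ((2 ^ (B * 2 ^ (r - 1)) * (2 * real r * 2 ^ (r - 1) * real (r + 1) ^ r) * exp 1) ^ n
      * (y ^ r) ^ n) * fact n"
    by (simp add: power_mult_distrib mult_ac)
  then have "N \<le> (2 ^ (B * 2 ^ (r - 1)) * (2 * real r * 2 ^ (r - 1) * real (r + 1) ^ r) * exp 1) ^ n * (y ^ r) ^ n"
    by (simp only: mult_le_cancel_right_pos fact_gt_zero)
  then show ?thesis
    unfolding y_def x_def scale_power_eq[OF r n] N_def B_def by simp
qed

text \<open>
  An antichain of $n$ tuples needs only $k = \lceil n^{1/(r-1)} \rceil$, so the entries of its tuples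
  take at most $rk + 1 \le 3 r n^{1/(r-1)}$ values.
\<close>

lemma num_pattern_free_lower:
  assumes P: "partite_pattern r P" and r: "r \<ge> 2" and n: "n > 0"
  shows "real n powr ((real r - 1 - 1 / (real r - 1)) * real n)
    \<le> ((3 * real r * exp 1) ^ r) ^ n * real (num_pattern_free r P n)"
proof -
  define x where "x = real n powr (1 / real (r - 1))"
  have x1: "x \<ge> 1" using n by (simp add: x_def ge_one_powr_ge_zero)
  have xpow: "x ^ (r - 1) = real n"
    using n r by (simp add: x_def powr_realpow[symmetric] powr_powr)
  define k where "k = nat \<lceil>x\<rceil>"
  have k: "x \<le> real k" "real k \<le> 2 * x" using x1 unfolding k_def by linarith+
  have "real n \<le> real k ^ (r - 1)" unfolding xpow[symmetric] using k x1 by (intro power_mono) auto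
  then have "real n \<le> real (k ^ (r - 1))" by simp
  then have "n \<le> k ^ (r - 1)" by (simp only: of_nat_le_iff)
  define N where "N = real (num_pattern_free r P n)"
  have "real (r * k + 1) \<le> 3 * r * x"
  proof -
    have "real r * real k \<le> real r * (2 * x)" using k by (intro mult_left_mono) auto
    moreover have "1 * 1 \<le> real r * x" using r x1 by (intro mult_mono) auto
    ultimately show ?thesis by simp
  qed
  then have K: "((real (r * k + 1)) ^ n) ^ r \<le> ((3 * r * x) ^ n) ^ r"
    by (intro power_mono) auto
  have "(real n ^ n) ^ r \<le> (exp (real n) * fact n) ^ r"
    by (intro power_mono power_le_exp_fact) simp
  also have "\<dots> = exp (real n) ^ r * fact n ^ r" by (rule power_mult_distrib)
  also have "\<dots> \<le> exp (real n) ^ r * (((3 * r * x) ^ n) ^ r * N)"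
  proof (rule mult_left_mono)
    have "real (fact n ^ r) \<le> real (((r * k + 1) ^ n) ^ r * num_pattern_free r P n)"
      using num_pattern_free_lower_nat[OF P r \<open>n \<le> k ^ (r - 1)\<close>] by (simp only: of_nat_le_iff)
    then have "fact n ^ r \<le> (real (r * k + 1) ^ n) ^ r * N"
      by (simp only: of_nat_power of_nat_mult of_nat_fact N_def)
    also have "\<dots> \<le> ((3 * r * x) ^ n) ^ r * N" using K by (intro mult_right_mono) (auto simp: N_def)
    finally show "fact n ^ r \<le> ((3 * r * x) ^ n) ^ r * N" .
  qed simp
  also have "exp (real n) = exp 1 ^ n" by (simp add: exp_of_nat_mult[symmetric])
  also have "(exp 1 ^ n) ^ r * (((3 * r * x) ^ n) ^ r * N) = ((3 * real r * exp 1) ^ r) ^ n * N * (x ^ r) ^ n"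
    by (simp add: power_mult_distrib power_mult[symmetric] mult_ac)
  also have "(real n ^ n) ^ r = (real n ^ r) ^ n" by (simp add: power_mult[symmetric] mult.commute)
  finally have "(real n ^ r) ^ n / (x ^ r) ^ n \<le> ((3 * real r * exp 1) ^ r) ^ n * N"
    using x1 by (simp add: pos_divide_le_eq)
  moreover have "(real n ^ r) ^ n / (x ^ r) ^ n = ((real n / x) ^ r) ^ n" by (simp add: power_divide)
  ultimately show ?thesis
    unfolding x_def scale_power_eq[OF r n] N_def by simp
qed

theorem theorem1p13:
  fixes r :: nat
  assumes "r \<ge> 2"
  shows "\<exists>C :: real. \<forall>P. partite_pattern r P \<longrightarrow>
    (\<forall>\<^sub>F n in sequentially.
       exp (- C * real n) * real n powr ((real r - 1 - 1 / (real r - 1)) * real n)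
         \<le> real (num_pattern_free r P n) \<and>
       real (num_pattern_free r P n)
         \<le> exp (C * real n) * real n powr ((real r - 1 - 1 / (real r - 1)) * real n))"
proof -
  define U :: real where
    "U = 2 ^ (2 ^ r * (2 * r) * 2 ^ (r - 1)) * (2 * real r * 2 ^ (r - 1) * real (r + 1) ^ r) * exp 1"
  define V where "V = (3 * real r * exp 1) ^ r"
  define C where "C = max (ln U) (ln V)"
  have UV: "U > 0" "V > 0" using assms by (auto simp: U_def V_def)
  have C: "U ^ n \<le> exp (C * real n)" "V ^ n \<le> exp (C * real n)" for n
  proof -
    have "U \<le> exp C" "V \<le> exp C"
      using UV by (metis C_def exp_le_cancel_iff exp_ln max.cobounded1, metis C_def UV(2) exp_le_cancel_iff exp_ln max.cobounded2)
    then have "U ^ n \<le> exp C ^ n" "V ^ n \<le> exp C ^ n" using UV by (auto intro: power_mono)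
    then show "U ^ n \<le> exp (C * real n)" "V ^ n \<le> exp (C * real n)"
      by (simp_all add: exp_of_nat2_mult)
  qed
  show ?thesis
  proof (intro exI[of _ C] allI impI)
    fix P assume P: "partite_pattern r P"
    show "\<forall>\<^sub>F n in sequentially.
       exp (- C * real n) * real n powr ((real r - 1 - 1 / (real r - 1)) * real n)
         \<le> real (num_pattern_free r P n) \<and>
       real (num_pattern_free r P n)
         \<le> exp (C * real n) * real n powr ((real r - 1 - 1 / (real r - 1)) * real n)"
      using eventually_gt_at_top[of 0]
    proof eventually_elim
      case (elim n)
      let ?g = "real n powr ((real r - 1 - 1 / (real r - 1)) * real n)"
      have "?g \<le> V ^ n * real (num_pattern_free r P n)"
        using num_pattern_free_lower[OF P assms elim] by (simp only: V_def)
      also have "\<dots> \<le> exp (C * real n) * real (num_pattern_free r P n)"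
        using C by (intro mult_right_mono) auto
      finally have "exp (- C * real n) * ?g \<le> real (num_pattern_free r P n)"
        by (simp add: exp_minus field_simps)
      moreover have "real (num_pattern_free r P n) \<le> U ^ n * ?g"
        using num_pattern_free_upper[OF P assms elim] by (simp only: U_def)
      then have "real (num_pattern_free r P n) \<le> exp (C * real n) * ?g"
        using C(1)[of n] by (meson mult_right_mono order_trans powr_ge_zero)
      ultimately show ?case by blast
    qed
  qed
qed

end
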